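(* Let $a<b$ and $n\ge1$. For any bounded measurable functions $B_0,N_0:[a,b]\to\mathbb{R}^{n\times n}$ and $B_1,B_2,N_1,N_2:[a,b]^2\to\mathbb{R}^{n\times n}$, we have, as operators on $L_2([a,b];\mathbb{R}^n)$, $$\mathcal{P}_{\{R_0,R_1,R_2\}}=\mathcal{P}_{\{B_0,B_1,B_2\}}\,\mathcal{P}_{\{N_0,N_1,N_2\}},$$ where $$R_0(s)=B_0(s)N_0(s),$$ $$R_1(s,\theta)=B_0(s)N_1(s,\theta)+B_1(s,\theta)N_0(\theta)+\int_a^\theta B_1(s,\xi)N_2(\xi,\theta)\,d\xi+\int_\theta^sB_1(s,\xi)N_1(\xi,\theta)\,d\xi+\int_s^bB_2(s,\xi)N_1(\xi,\theta)\,d\xi,$$ $$R_2(s,\theta)=B_0(s)N_2(s,\theta)+B_2(s,\theta)N_0(\theta)+\int_a^sB_1(s,\xi)N_2(\xi,\theta)\,d\xi+\int_s^\theta B_2(s,\xi)N_2(\xi,\theta)\,d\xi+\int_\theta^bB_2(s,\xi)N_1(\xi,\theta)\,d\xi.$$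
   Context: For bounded measurable $N_0:[a,b]\to\mathbb{R}^{n\times n}$ and $N_1,N_2:[a,b]^2\to\mathbb{R}^{n\times n}$, the 3-PI operator $\mathcal{P}_{\{N_0,N_1,N_2\}}$ on $L_2([a,b];\mathbb{R}^n)$ is $$(\mathcal{P}_{\{N_0,N_1,N_2\}}\mathbf{x})(s)=N_0(s)\mathbf{x}(s)+\int_a^s N_1(s,\theta)\mathbf{x}(\theta)\,d\theta+\int_s^b N_2(s,\theta)\mathbf{x}(\theta)\,d\theta .$$ *)

theory Defs
  imports "HOL-Analysis.Analysis"
begin

text \<open>
  "Measurable" means Lebesgue measurable throughout, and only the values of the kernels
  on \<open>[a,b]\<close> and \<open>[a,b]\<^sup>2\<close> matter.
\<close>

definition bounded_measurable_on :: "'a::euclidean_space set \<Rightarrow> ('a \<Rightarrow> 'b::real_normed_vector) \<Rightarrow> bool"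
  where "bounded_measurable_on S f \<longleftrightarrow>
    f \<in> borel_measurable (lebesgue_on S) \<and> bounded (f ` S)"

definition PI_parameters ::
  "real \<Rightarrow> real \<Rightarrow> (real \<Rightarrow> real^'n^'n) \<Rightarrow> (real \<Rightarrow> real \<Rightarrow> real^'n^'n) \<Rightarrow> (real \<Rightarrow> real \<Rightarrow> real^'n^'n) \<Rightarrow> bool"
  where "PI_parameters a b N0 N1 N2 \<longleftrightarrow>
    bounded_measurable_on {a..b} N0 \<and>
    bounded_measurable_on ({a..b} \<times> {a..b}) (\<lambda>(s, \<theta>). N1 s \<theta>) \<and>
    bounded_measurable_on ({a..b} \<times> {a..b}) (\<lambda>(s, \<theta>). N2 s \<theta>)"

text \<open>
  The space \<open>L\<^sub>2([a,b]; \<real>\<^sup>n)\<close>: square-integrable functions modulo equality almost everywhere.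
\<close>

definition L2_fun :: "real \<Rightarrow> real \<Rightarrow> (real \<Rightarrow> real^'n) set"
  where "L2_fun a b = {x. x \<in> borel_measurable (lebesgue_on {a..b}) \<and>
    integrable (lebesgue_on {a..b}) (\<lambda>s. (norm (x s))\<^sup>2)}"

definition L2_eq :: "real \<Rightarrow> real \<Rightarrow> ((real \<Rightarrow> real^'n) \<times> (real \<Rightarrow> real^'n)) set"
  where "L2_eq a b = {(x, y). x \<in> L2_fun a b \<and> y \<in> L2_fun a b \<and>
    (AE s in lebesgue_on {a..b}. x s = y s)}"

definition L2_space :: "real \<Rightarrow> real \<Rightarrow> (real \<Rightarrow> real^'n) set set"
  where "L2_space a b = L2_fun a b // L2_eq a b"

lemma equiv_L2_eq: "equiv (L2_fun a b) (L2_eq a b)"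
proof (rule equivI)
  show "L2_eq a b \<subseteq> L2_fun a b \<times> L2_fun a b"
    by (auto simp: L2_eq_def)
  show "refl_on (L2_fun a b) (L2_eq a b)"
    by (auto simp: L2_eq_def refl_on_def)
  show "sym (L2_eq a b)"
    by (auto simp: L2_eq_def sym_def elim: AE_mp)
  show "trans (L2_eq a b)"
    unfolding L2_eq_def trans_def by (auto elim: AE_mp)
qed

text \<open>
  The action of a 3-PI operator on representatives. The integrals are Lebesgue integrals, with
  the usual orientation convention when the limits are reversed.
\<close>

definition PI_fun ::
  "real \<Rightarrow> real \<Rightarrow> (real \<Rightarrow> real^'n^'n) \<Rightarrow> (real \<Rightarrow> real \<Rightarrow> real^'n^'n) \<Rightarrow> (real \<Rightarrow> real \<Rightarrow> real^'n^'n) \<Rightarrow>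
    (real \<Rightarrow> real^'n) \<Rightarrow> real \<Rightarrow> real^'n"
  where "PI_fun a b N0 N1 N2 x s =
    N0 s *v x s
    + (LINT \<theta>=a..s|lebesgue. (N1 s \<theta> *v x \<theta>))
    + (LINT \<theta>=s..b|lebesgue. (N2 s \<theta> *v x \<theta>))"

text \<open>
  The induced operator on classes. The union over all representatives is again an element of
  \<open>L2_space\<close> only if \<open>PI_fun\<close> respects equality almost everywhere and square integrability on
  that class.
\<close>

definition PI_op ::
  "real \<Rightarrow> real \<Rightarrow> (real \<Rightarrow> real^'n^'n) \<Rightarrow> (real \<Rightarrow> real \<Rightarrow> real^'n^'n) \<Rightarrow> (real \<Rightarrow> real \<Rightarrow> real^'n^'n) \<Rightarrow>
    (real \<Rightarrow> real^'n) set \<Rightarrow> (real \<Rightarrow> real^'n) set"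
  where "PI_op a b N0 N1 N2 X = (\<Union>x\<in>X. L2_eq a b `` {PI_fun a b N0 N1 N2 x})"

end

theory Submission
  imports Defs
begin

text \<open>
  A 3-PI operator is a multiplication operator plus an integral operator with the single kernel that
  equals \<open>N1\<close> below the diagonal and \<open>N2\<close> above it. In this form the composition formula is Fubini's
  theorem, and \<open>R1\<close>, \<open>R2\<close> are the two restrictions of
  \<open>B0 N + B N0 + \<integral> B(s,\<xi>) N(\<xi>,\<theta>) d\<xi>\<close>, whose integral breaks into three pieces at \<open>s\<close> and \<open>\<theta>\<close>.
  The kernels are only Lebesgue measurable on the square, so their sections need not be measurable;
  everything is therefore transferred to Borel functions agreeing almost everywhere, for which
  almost every section agrees almost everywhere.
\<close>

text \<open>The formulas for \<open>R1\<close> and \<open>R2\<close> are imposed on the whole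
  square: also on the far side of the diagonal, where an integral runs backwards, and at points
  where an integrand is not measurable, where the integral has the default value 0. Measurability
  may ignore null sets, boundedness may not. Hence two separate tasks. That \<open>R1\<close> and
  \<open>R2\<close> are admissible kernels needs a signed weight for oriented integrals and a norm
  estimate that survives the default value. The operator identity needs the kernels only up to a
  null set of the plane: almost every section of such a set is null, and equality in L2 forgets the
  remaining values of \<open>s\<close>. Borel representatives are chosen bounded everywhere and zero
  everywhere outside the interval or square, so that domination works for each \<open>s\<close> and
  integrals may run over the whole line. The dominating functions are integrable because an L2
  function on a bounded interval is also L1.\<close>

section \<open>Matrix products as bounded bilinear maps\<close>

lemma bounded_bilinear_matrix_mult:
  "bounded_bilinear ((**) :: real^'n^'m \<Rightarrow> real^'p^'n \<Rightarrow> real^'p^'m)"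
  unfolding bilinear_conv_bounded_bilinear[symmetric] bilinear_def
  by (auto intro!: linearI simp: matrix_matrix_mult_def vec_eq_iff algebra_simps sum.distrib
      sum_distrib_left)

lemma bounded_bilinear_matrix_vector_mult:
  "bounded_bilinear ((*v) :: real^'n^'m \<Rightarrow> real^'n \<Rightarrow> real^'m)"
  unfolding bilinear_conv_bounded_bilinear[symmetric] bilinear_def
  by (auto intro!: linearI simp: matrix_vector_mult_def vec_eq_iff algebra_simps sum.distrib
      sum_distrib_left)

lemma borel_measurable_bounded_bilinear:
  fixes prd :: "'a::euclidean_space \<Rightarrow> 'b::euclidean_space \<Rightarrow> 'c::real_normed_vector"
  assumes "bounded_bilinear prd" "f \<in> borel_measurable M" "g \<in> borel_measurable M"
  shows "(\<lambda>x. prd (f x) (g x)) \<in> borel_measurable M"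
  using assms(2,3)
  by (rule borel_measurable_continuous_Pair)
    (intro bounded_bilinear.continuous_on[OF assms(1)] continuous_intros)

lemmas borel_measurable_matrix_mult [measurable (raw)] =
  borel_measurable_bounded_bilinear[OF bounded_bilinear_matrix_mult]

lemmas borel_measurable_matrix_vector_mult [measurable (raw)] =
  borel_measurable_bounded_bilinear[OF bounded_bilinear_matrix_vector_mult]

subsection \<open>Borel representatives\<close>

text \<open>Each coordinate of the zero extension is a real Lebesgue measurable function, hence
  almost everywhere equal to a Borel one. Only finitely many coordinates occur, so their exceptional
  null sets can be discarded together.\<close>

lemma borel_representative:
  fixes f :: "'a::euclidean_space \<Rightarrow> 'b::euclidean_space"
  assumes f: "f \<in> borel_measurable (lebesgue_on S)" and S[measurable]: "S \<in> sets borel"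
  obtains g where "g \<in> borel_measurable borel" "\<And>x. x \<notin> S \<Longrightarrow> g x = 0"
    "AE x in lborel. x \<in> S \<longrightarrow> f x = g x"
proof -
  have "(\<lambda>x. if x \<in> S then f x else 0) \<in> borel_measurable lebesgue"
    using f S by (intro borel_measurable_if_I) auto
  then have "\<exists>h\<in>borel_measurable lborel. AE x in lborel. (if x \<in> S then f x else 0) \<bullet> i = h x" for i
    by (intro completion_ex_borel_measurable_real) simp
  then have "\<forall>i. \<exists>h. h \<in> borel_measurable lborel \<and>
      (AE x in lborel. (if x \<in> S then f x else 0) \<bullet> i = h x)"
    unfolding Bex_def by blast
  from choice[OF this] obtain h where "\<forall>i. h i \<in> borel_measurable lborel \<and>
      (AE x in lborel. (if x \<in> S then f x else 0) \<bullet> i = h i x)"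
    by blast
  then have [measurable]: "\<And>i. h i \<in> borel_measurable borel"
    and ae: "\<And>i. AE x in lborel. (if x \<in> S then f x else 0) \<bullet> i = h i x"
    by simp_all
  \<comment> \<open>The coordinates \<open>h i\<close> vanish outside \<open>S\<close> only almost
    everywhere; the indicator makes this hold at every point.\<close>
  define g where "g x = indicator S x *\<^sub>R (\<Sum>i\<in>Basis. h i x *\<^sub>R i)" for x
  have "AE x in lborel. \<forall>i\<in>Basis. (if x \<in> S then f x else 0) \<bullet> i = h i x"
    using ae by (intro AE_finite_allI) auto
  then have "AE x in lborel. x \<in> S \<longrightarrow> f x = g x"
  proof eventually_elim
    case (elim x)
    show ?case
    proof
      assume "x \<in> S"
      then have "g x = (\<Sum>i\<in>Basis. (f x \<bullet> i) *\<^sub>R i)"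
        using elim by (simp add: g_def)
      then show "f x = g x" by (simp add: euclidean_representation)
    qed
  qed
  moreover have "g \<in> borel_measurable borel"
    unfolding g_def[abs_def] by measurable
  ultimately show ?thesis using that[of g] by (simp add: g_def)
qed

text \<open>Both the bound and the vanishing are demanded everywhere, not almost everywhere, so
  every section of a two-variable representative inherits them.\<close>

definition bounded_borel_on :: "'a::euclidean_space set \<Rightarrow> ('a \<Rightarrow> 'b::real_normed_vector) \<Rightarrow> bool"
  where "bounded_borel_on S g \<longleftrightarrow>
    g \<in> borel_measurable borel \<and> bounded (range g) \<and> (\<forall>x. x \<notin> S \<longrightarrow> g x = 0)"

lemma bounded_borel_on_bound:
  assumes "bounded_borel_on S g"
  obtains C where "0 \<le> C" "\<And>x. norm (g x) \<le> C"
proof -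
  from assms obtain C where C: "\<And>x. norm (g x) \<le> C"
    unfolding bounded_borel_on_def bounded_iff by auto
  moreover have "0 \<le> C" using order_trans[OF norm_ge_zero C] .
  ultimately show ?thesis using that by blast
qed

lemma bounded_borel_representative:
  fixes f :: "'a::euclidean_space \<Rightarrow> 'b::euclidean_space"
  assumes f: "bounded_measurable_on S f" and S: "S \<in> sets borel"
  obtains g where "bounded_borel_on S g" "AE x in lborel. x \<in> S \<longrightarrow> f x = g x"
proof -
  obtain C where C: "\<And>x. x \<in> S \<Longrightarrow> norm (f x) \<le> C"
    using f by (auto simp: bounded_measurable_on_def bounded_iff)
  have fm: "f \<in> borel_measurable (lebesgue_on S)" using f by (simp add: bounded_measurable_on_def)
  obtain g where [measurable]: "g \<in> borel_measurable borel" and g0: "\<And>x. x \<notin> S \<Longrightarrow> g x = 0"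
    and ae: "AE x in lborel. x \<in> S \<longrightarrow> f x = g x"
    using borel_representative[OF fm S] by blast
  \<comment> \<open>\<open>g\<close> may exceed the bound \<open>C\<close> of \<open>f\<close> on a
    null set; cutting it off there keeps it Borel and almost everywhere equal to \<open>f\<close>.
    The bound \<open>max C 0\<close> covers an empty \<open>S\<close>, for which \<open>C\<close>
    may be negative.\<close>
  define g' where "g' x = (if norm (g x) \<le> C then g x else 0)" for x
  have "bounded (range g')"
    by (rule boundedI[where B = "max C 0"]) (auto simp: g'_def)
  moreover have "g' \<in> borel_measurable borel"
    unfolding g'_def[abs_def] by measurable
  ultimately have "bounded_borel_on S g'"
    by (simp add: bounded_borel_on_def) (simp add: g'_def g0)
  moreover have "AE x in lborel. x \<in> S \<longrightarrow> f x = g' x"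
    using ae
  proof eventually_elim
    case (elim x)
    then show ?case using C[of x] by (auto simp: g'_def)
  qed
  ultimately show ?thesis by (rule that)
qed

text \<open>Completeness of Lebesgue measure transfers measurability from \<open>g\<close> to
  \<open>f\<close>. Boundedness must be assumed for \<open>f\<close> itself, since an almost
  everywhere equality says nothing about it.\<close>

lemma bounded_measurable_onI:
  fixes f :: "'a::euclidean_space \<Rightarrow> 'b::euclidean_space"
  assumes [measurable]: "g \<in> borel_measurable borel" "S \<in> sets borel"
    and ae: "AE x in lborel. x \<in> S \<longrightarrow> f x = g x" and "bounded (f ` S)"
  shows "bounded_measurable_on S f"
proof -
  have "(\<lambda>x. if x \<in> S then g x else 0) \<in> borel_measurable lborel" by measurable
  then have "(\<lambda>x. if x \<in> S then g x else 0) \<in> borel_measurable lebesgue"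
    by (rule measurable_completion)
  moreover have "AE x in lebesgue. (if x \<in> S then g x else 0) = (if x \<in> S then f x else 0)"
    using AE_completion[OF ae] by eventually_elim auto
  ultimately have "(\<lambda>x. if x \<in> S then f x else 0) \<in> borel_measurable lebesgue"
    by (rule borel_measurable_AE)
  then have "f \<in> borel_measurable (lebesgue_on S)" by (rule borel_measurable_if_D)
  with assms show ?thesis by (simp add: bounded_measurable_on_def)
qed

text \<open>No measurability of \<open>f\<close> is assumed: it follows from the almost everywhere
  equality, by completeness. This is what turns integrals of the original kernels into Borel
  integrals.\<close>

lemma
  fixes f g :: "'a::euclidean_space \<Rightarrow> 'b::euclidean_space"
  assumes g: "g \<in> borel_measurable borel" and ae: "AE x in lborel. f x = g x"
  shows integral_lebesgue_eq_lborel: "integral\<^sup>L lebesgue f = integral\<^sup>L lborel g"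
    and integrable_lebesgue_iff_lborel: "integrable lebesgue f \<longleftrightarrow> integrable lborel g"
proof -
  have ae': "AE x in lebesgue. f x = g x" using ae by (rule AE_completion)
  have gl: "g \<in> borel_measurable lebesgue" using g by (intro measurable_completion) simp
  have fl: "f \<in> borel_measurable lebesgue"
    by (rule borel_measurable_AE[OF gl]) (use ae' in \<open>auto elim: eventually_mono\<close>)
  show "integral\<^sup>L lebesgue f = integral\<^sup>L lborel g"
    using integral_cong_AE[OF fl gl ae'] g by (simp add: integral_completion)
  show "integrable lebesgue f \<longleftrightarrow> integrable lborel g"
    using integrable_cong_AE[OF fl gl ae'] g by (simp add: integrable_completion)
qed

lemma integrable_indicator_Icc: "integrable lborel (indicator {a..b} :: real \<Rightarrow> real)"
  by (intro integrable_real_indicator) (auto simp: emeasure_lborel_Icc_eq)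

section \<open>Almost everywhere statements on products\<close>

lemma AE_lborel_sections:
  fixes P :: "'a::euclidean_space \<times> 'b::euclidean_space \<Rightarrow> bool"
  assumes "AE z in lborel. P z"
  shows AE_lborel_section1: "AE x in lborel. AE y in lborel. P (x, y)"
    and AE_lborel_section2: "AE y in lborel. AE x in lborel. P (x, y)"
proof -
  have *: "AE z in (lborel \<Otimes>\<^sub>M lborel). P z" using assms unfolding lborel_prod .
  then show "AE x in lborel. AE y in lborel. P (x, y)" by (rule lborel_pair.AE_pair)
  \<comment> \<open>Exchanging the two quantifiers requires a measurable predicate, which
    \<open>P\<close> need not be; the complement of a measurable null set \<open>N\<close>
    containing all exceptions takes its place.\<close>
  obtain N where N: "N \<in> null_sets (lborel \<Otimes>\<^sub>M lborel)" "{z. \<not> P z} \<subseteq> N"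
    using * by (auto elim!: AE_E simp: null_sets_def space_pair_measure)
  have NP: "P z" if "z \<notin> N" for z using N that by auto
  have "{z \<in> space (lborel \<Otimes>\<^sub>M lborel). (fst z, snd z) \<notin> N} = space (lborel \<Otimes>\<^sub>M lborel) - N"
    by auto
  also have "\<dots> \<in> sets (lborel \<Otimes>\<^sub>M lborel)"
    using N(1) by (intro sets.compl_sets) (simp add: null_sets_def)
  finally have "{z \<in> space (lborel \<Otimes>\<^sub>M lborel). (fst z, snd z) \<notin> N} \<in> sets (lborel \<Otimes>\<^sub>M lborel)" .
  note comm = lborel_pair.AE_commute[OF this]
  have "AE x in lborel. AE y in lborel. (x, y) \<notin> N"
    using lborel_pair.AE_pair[OF AE_not_in[OF N(1)]] .
  then have "AE y in lborel. AE x in lborel. (x, y) \<notin> N" unfolding comm .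
  then show "AE y in lborel. AE x in lborel. P (x, y)"
    by (elim eventually_mono) (auto intro: NP)
qed

text \<open>A null set times a whole space is null. Applied with \<open>P\<close> itself a statement
  about almost every point of a section, this lets section facts be combined with facts about almost
  every pair.\<close>

lemma
  fixes P :: "'a::euclidean_space \<Rightarrow> bool"
  assumes "AE x in lborel. P x"
  shows AE_lborel_fst: "AE z in (lborel :: ('a \<times> 'b::euclidean_space) measure). P (fst z)"
    and AE_lborel_snd: "AE z in (lborel :: ('b::euclidean_space \<times> 'a) measure). P (snd z)"
proof -
  obtain N where N: "N \<in> null_sets lborel" "{z. \<not> P z} \<subseteq> N"
    using assms by (auto elim!: AE_E simp: null_sets_def)
  have NP: "P z" if "z \<notin> N" for z using N that by auto
  have [measurable]: "N \<in> sets borel" using N by (auto simp: null_sets_def)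
  have "AE z in (lborel \<Otimes>\<^sub>M lborel :: ('a \<times> 'b) measure). fst z \<notin> N"
  proof (rule lborel_pair.AE_pair_measure)
    show "{z \<in> space (lborel \<Otimes>\<^sub>M lborel). fst z \<notin> N} \<in> sets (lborel \<Otimes>\<^sub>M lborel)"
      by measurable
  qed (use AE_not_in[OF N(1)] in auto)
  then show "AE z in (lborel :: ('a \<times> 'b) measure). P (fst z)"
    unfolding lborel_prod by (elim eventually_mono) (auto intro: NP)
  have "AE z in (lborel \<Otimes>\<^sub>M lborel :: ('b \<times> 'a) measure). snd z \<notin> N"
  proof (rule lborel_pair.AE_pair_measure)
    show "{z \<in> space (lborel \<Otimes>\<^sub>M lborel). snd z \<notin> N} \<in> sets (lborel \<Otimes>\<^sub>M lborel)"
      by measurable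
  qed (use AE_not_in[OF N(1)] in auto)
  then show "AE z in (lborel :: ('b \<times> 'a) measure). P (snd z)"
    unfolding lborel_prod by (elim eventually_mono) (auto intro: NP)
qed

subsection \<open>Measurability of the composed kernels\<close>

lemma bounded_measurable_on_cong:
  fixes f g :: "'a::euclidean_space \<Rightarrow> 'b::real_normed_vector"
  assumes "\<And>x. x \<in> S \<Longrightarrow> f x = g x"
  shows "bounded_measurable_on S f \<longleftrightarrow> bounded_measurable_on S g"
proof -
  have "f \<in> borel_measurable (lebesgue_on S) \<longleftrightarrow> g \<in> borel_measurable (lebesgue_on S)"
    by (rule measurable_cong) (use assms in \<open>auto simp: space_restrict_space\<close>)
  moreover have "f ` S = g ` S" using assms by auto
  ultimately show ?thesis by (simp add: bounded_measurable_on_def)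
qed

lemma bounded_measurable_on_add:
  fixes f g :: "'a::euclidean_space \<Rightarrow> 'b::euclidean_space"
  assumes "bounded_measurable_on S f" "bounded_measurable_on S g"
  shows "bounded_measurable_on S (\<lambda>x. f x + g x)"
  using assms unfolding bounded_measurable_on_def
  by (intro conjI borel_measurable_add bounded_plus_comp) auto

lemma bounded_bilinear_norm_le:
  assumes "bounded_bilinear prd"
  obtains K where "0 < K" "\<And>x y C D. norm x \<le> C \<Longrightarrow> norm y \<le> D \<Longrightarrow> norm (prd x y) \<le> C * D * K"
proof -
  obtain K where K: "0 < K" "\<And>x y. norm (prd x y) \<le> norm x * norm y * K"
    using bounded_bilinear.pos_bounded[OF assms] by blast
  have "norm (prd x y) \<le> C * D * K" if "norm x \<le> C" "norm y \<le> D" for x y C D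
  proof -
    have "0 \<le> C" using norm_ge_zero that(1) by (rule order_trans)
    then have "norm x * norm y * K \<le> C * D * K"
      using that K(1) by (intro mult_right_mono mult_mono) auto
    with K(2)[of x y] show ?thesis by simp
  qed
  with K(1) show ?thesis by (rule that)
qed

lemma bounded_measurable_on_matrix_mult:
  fixes f g :: "'a::euclidean_space \<Rightarrow> real^'n^'n"
  assumes f: "bounded_measurable_on S f" and g: "bounded_measurable_on S g"
  shows "bounded_measurable_on S (\<lambda>x. f x ** g x)"
proof -
  obtain K where K: "0 < K" "\<And>A B C D. norm (A :: real^'n^'n) \<le> C \<Longrightarrow> norm (B :: real^'n^'n) \<le> D \<Longrightarrow>
      norm (A ** B) \<le> C * D * K"
    using bounded_bilinear_norm_le[OF bounded_bilinear_matrix_mult] by blast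
  obtain C D where C: "\<And>x. x \<in> S \<Longrightarrow> norm (f x) \<le> C" and D: "\<And>x. x \<in> S \<Longrightarrow> norm (g x) \<le> D"
    using f g unfolding bounded_measurable_on_def bounded_iff by auto
  have "norm (f x ** g x) \<le> C * D * K" if "x \<in> S" for x
    using K(2) C[OF that] D[OF that] by blast
  then have "bounded ((\<lambda>x. f x ** g x) ` S)" by (auto intro: boundedI)
  with f g show ?thesis
    by (simp add: bounded_measurable_on_def borel_measurable_matrix_mult)
qed

text \<open>Composing a merely Lebesgue measurable \<open>f\<close> with a projection goes through a
  Borel representative, whose exceptional set becomes a null strip in the plane.\<close>

lemma bounded_measurable_on_Times:
  fixes f :: "real \<Rightarrow> 'b::euclidean_space"
  assumes f: "bounded_measurable_on {a..b} f"
  shows bounded_measurable_on_fst: "bounded_measurable_on ({a..b} \<times> {c..d}) (\<lambda>(s, \<theta>::real). f s)"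
    and bounded_measurable_on_snd: "bounded_measurable_on ({c..d} \<times> {a..b}) (\<lambda>(s::real, \<theta>). f \<theta>)"
proof -
  obtain g where g: "bounded_borel_on {a..b} g" "AE x in lborel. x \<in> {a..b} \<longrightarrow> f x = g x"
    using bounded_borel_representative[OF f] by auto
  have [measurable]: "g \<in> borel_measurable borel" using g by (simp add: bounded_borel_on_def)
  have bdd: "bounded (f ` {a..b})" using f by (simp add: bounded_measurable_on_def)
  show "bounded_measurable_on ({a..b} \<times> {c..d}) (\<lambda>(s, \<theta>::real). f s)"
  proof (rule bounded_measurable_onI)
    show "(\<lambda>z :: real \<times> real. g (fst z)) \<in> borel_measurable borel"
      by (simp add: borel_prod[symmetric])
    show "AE z in lborel. z \<in> {a..b} \<times> {c..d} \<longrightarrow> (case z of (s, \<theta>) \<Rightarrow> f s) = g (fst z)"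
      using AE_lborel_fst[OF g(2)] by eventually_elim auto
  qed (use bdd in \<open>auto intro: bounded_subset simp: borel_prod[symmetric]\<close>)
  show "bounded_measurable_on ({c..d} \<times> {a..b}) (\<lambda>(s::real, \<theta>). f \<theta>)"
  proof (rule bounded_measurable_onI)
    show "(\<lambda>z :: real \<times> real. g (snd z)) \<in> borel_measurable borel"
      by (simp add: borel_prod[symmetric])
    show "AE z in lborel. z \<in> {c..d} \<times> {a..b} \<longrightarrow> (case z of (s, \<theta>) \<Rightarrow> f \<theta>) = g (snd z)"
      using AE_lborel_snd[OF g(2)] by eventually_elim auto
  qed (use bdd in \<open>auto intro: bounded_subset simp: borel_prod[symmetric]\<close>)
qed

text \<open>
  Integrating against this weight expresses \<open>LINT \<xi>=u..v\<close> for either order of the limits, which makes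
  joint measurability in \<open>(u, v)\<close> accessible to Fubini-type lemmas.
\<close>

definition orient :: "real \<Rightarrow> real \<Rightarrow> real \<Rightarrow> real"
  where "orient u v \<xi> = (if u < \<xi> \<and> \<xi> < v then 1 else if v < \<xi> \<and> \<xi> < u then - 1 else 0)"

lemma orient_cases: "orient u v \<xi> = 0 \<or> orient u v \<xi> = 1 \<or> orient u v \<xi> = - 1"
  by (simp add: orient_def)

section \<open>Integrals with variable limits\<close>

lemma interval_integral_orient:
  fixes f :: "real \<Rightarrow> 'b::{banach, second_countable_topology}" and u v :: real
  shows "(LINT \<xi>=u..v|lebesgue. f \<xi>) = (LINT \<xi>|lebesgue. orient u v \<xi> *\<^sub>R f \<xi>)"
proof (cases "u \<le> v")
  case True
  then have "orient u v = indicator {u<..<v}"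
    by (auto simp: orient_def indicator_def fun_eq_iff)
  then show ?thesis using True
    by (simp add: interval_lebesgue_integral_def set_lebesgue_integral_def)
next
  case False
  then have "orient u v = (\<lambda>\<xi>. - indicator {v<..<u} \<xi>)"
    by (auto simp: orient_def indicator_def fun_eq_iff)
  then show ?thesis using False
    by (simp add: interval_lebesgue_integral_def set_lebesgue_integral_def)
qed

text \<open>If \<open>f\<close> is not integrable, its integral is 0 by convention, and the bound
  holds because \<open>g\<close> is nonnegative. This bounds the composed kernels even at points
  whose sections are not measurable.\<close>

lemma norm_integral_le:
  fixes f :: "'a::euclidean_space \<Rightarrow> 'b::{banach, second_countable_topology}"
  assumes g: "integrable M g" and le: "\<And>x. norm (f x) \<le> g x"
  shows "norm (integral\<^sup>L M f) \<le> integral\<^sup>L M g"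
proof (cases "integrable M f")
  case True
  from Bochner_Integration.integral_norm_bound_integral[OF this g] show ?thesis using le by blast
next
  case False
  have "0 \<le> integral\<^sup>L M g"
    using order_trans[OF norm_ge_zero le] by (intro integral_nonneg_AE) auto
  with False show ?thesis by (simp add: not_integrable_integral_eq)
qed

text \<open>With \<open>u\<close> and \<open>v\<close> chosen among the constants \<open>a\<close>,
  \<open>b\<close> and the two coordinates, this covers all six integrals in \<open>R1\<close> and
  \<open>R2\<close>. For almost every point, the section of \<open>F\<close> and the section of
  \<open>G\<close> through it agree almost everywhere with those of the Borel representatives, so
  the integral agrees with a Borel function \<open>H\<close>.\<close>

lemma bounded_measurable_on_interval_integral:
  fixes F G :: "real \<Rightarrow> real \<Rightarrow> real^'n^'n" and u v :: "real \<times> real \<Rightarrow> real"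
  defines "Q a b \<equiv> {a..b::real} \<times> {a..b}"
  assumes F: "bounded_measurable_on (Q a b) (\<lambda>(s, \<theta>). F s \<theta>)"
    and G: "bounded_measurable_on (Q a b) (\<lambda>(s, \<theta>). G s \<theta>)"
    and [measurable]: "u \<in> borel_measurable borel" "v \<in> borel_measurable borel"
    and uv: "\<And>z. z \<in> Q a b \<Longrightarrow> u z \<in> {a..b} \<and> v z \<in> {a..b}"
  shows "bounded_measurable_on (Q a b)
    (\<lambda>(s, \<theta>). LINT \<xi>=u (s, \<theta>)..v (s, \<theta>)|lebesgue. (F s \<xi> ** G \<xi> \<theta>))"
proof -
  have Q [measurable]: "Q a b \<in> sets borel" unfolding Q_def by (simp add: borel_prod[symmetric])
  obtain F' where F': "bounded_borel_on (Q a b) F'"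
    and F'_ae: "AE z in lborel. z \<in> Q a b \<longrightarrow> (case z of (s, \<theta>) \<Rightarrow> F s \<theta>) = F' z"
    using bounded_borel_representative[OF F Q] by blast
  obtain G' where G': "bounded_borel_on (Q a b) G'"
    and G'_ae: "AE z in lborel. z \<in> Q a b \<longrightarrow> (case z of (s, \<theta>) \<Rightarrow> G s \<theta>) = G' z"
    using bounded_borel_representative[OF G Q] by blast
  have [measurable]: "F' \<in> borel_measurable (borel \<Otimes>\<^sub>M borel)" "G' \<in> borel_measurable (borel \<Otimes>\<^sub>M borel)"
    "u \<in> borel_measurable (borel \<Otimes>\<^sub>M borel)" "v \<in> borel_measurable (borel \<Otimes>\<^sub>M borel)"
    using F' G' by (simp_all add: bounded_borel_on_def borel_prod)
  define H where "H z = (LINT \<xi>|lborel. orient (u z) (v z) \<xi> *\<^sub>R (F' (fst z, \<xi>) ** G' (\<xi>, snd z)))" for z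
  have orient_in: "\<xi> \<in> {a..b}" if "orient (u z) (v z) \<xi> \<noteq> 0" "z \<in> Q a b" for \<xi> z
    using that uv[of z] by (auto simp: orient_def split: if_splits)
  show ?thesis
  proof (rule bounded_measurable_onI)
    have "H \<in> borel_measurable (borel \<Otimes>\<^sub>M borel)"
      unfolding H_def[abs_def] orient_def by measurable
    then show "H \<in> borel_measurable borel" by (simp add: borel_prod)
    show "AE z in lborel. z \<in> Q a b \<longrightarrow>
      (case z of (s, \<theta>) \<Rightarrow> LINT \<xi>=u (s, \<theta>)..v (s, \<theta>)|lebesgue. (F s \<xi> ** G \<xi> \<theta>)) = H z"
      using AE_lborel_fst[OF AE_lborel_section1[OF F'_ae]] AE_lborel_snd[OF AE_lborel_section2[OF G'_ae]]
    proof eventually_elim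
      case (elim z)
      show ?case
      proof
        assume z: "z \<in> Q a b"
        have "AE \<xi> in lborel. orient (u z) (v z) \<xi> *\<^sub>R (F (fst z) \<xi> ** G \<xi> (snd z)) =
          orient (u z) (v z) \<xi> *\<^sub>R (F' (fst z, \<xi>) ** G' (\<xi>, snd z))"
          using elim
        proof eventually_elim
          case (elim \<xi>)
          show ?case
          proof (cases "orient (u z) (v z) \<xi> = 0")
            case False
            with orient_in z have "\<xi> \<in> {a..b}" by blast
            with z elim show ?thesis by (auto simp: Q_def)
          qed simp
        qed
        then have "(LINT \<xi>|lebesgue. orient (u z) (v z) \<xi> *\<^sub>R (F (fst z) \<xi> ** G \<xi> (snd z))) = H z"
          unfolding H_def by (intro integral_lebesgue_eq_lborel) (simp_all add: orient_def)
        then show "(case z of (s, \<theta>) \<Rightarrow> LINT \<xi>=u (s, \<theta>)..v (s, \<theta>)|lebesgue. (F s \<xi> ** G \<xi> \<theta>)) = H z"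
          by (simp add: case_prod_beta interval_integral_orient)
      qed
    qed
    obtain K where K: "0 < K" "\<And>A B C D. norm (A :: real^'n^'n) \<le> C \<Longrightarrow> norm (B :: real^'n^'n) \<le> D \<Longrightarrow>
        norm (A ** B) \<le> C * D * K"
      using bounded_bilinear_norm_le[OF bounded_bilinear_matrix_mult] by blast
    obtain C D where C: "\<And>z. z \<in> Q a b \<Longrightarrow> norm (F (fst z) (snd z)) \<le> C"
      and D: "\<And>z. z \<in> Q a b \<Longrightarrow> norm (G (fst z) (snd z)) \<le> D"
      using F G unfolding bounded_measurable_on_def bounded_iff by (auto simp: case_prod_beta)
    define g :: "real \<Rightarrow> real" where "g \<xi> = indicator {a..b} \<xi> * (C * D * K)" for \<xi>
    have "integrable lborel (indicator {a..b} :: real \<Rightarrow> real)"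
      by (rule integrable_indicator_Icc)
    then have "integrable lebesgue g"
      unfolding g_def[abs_def] by (simp add: integrable_completion)
    \<comment> \<open>Needed for every \<open>z\<close> in the square, so the original
      \<open>F\<close> and \<open>G\<close> are estimated, not their representatives.\<close>
    have "norm (LINT \<xi>=u z..v z|lebesgue. (F (fst z) \<xi> ** G \<xi> (snd z))) \<le> integral\<^sup>L lebesgue g"
      if z: "z \<in> Q a b" for z
      unfolding interval_integral_orient
    proof (rule norm_integral_le)
      fix \<xi>
      show "norm (orient (u z) (v z) \<xi> *\<^sub>R (F (fst z) \<xi> ** G \<xi> (snd z))) \<le> g \<xi>"
      proof (cases "orient (u z) (v z) \<xi> = 0")
        case True
        have "0 \<le> C" "0 \<le> D" using C[OF z] D[OF z] by (auto intro: order_trans[OF norm_ge_zero])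
        then show ?thesis using True K by (simp add: g_def)
      next
        case False
        then have \<xi>: "\<xi> \<in> {a..b}" using orient_in z by blast
        have "\<bar>orient (u z) (v z) \<xi>\<bar> = 1" using False orient_cases[of "u z" "v z" \<xi>] by auto
        moreover have "norm (F (fst z) \<xi> ** G \<xi> (snd z)) \<le> C * D * K"
          using C[of "(fst z, \<xi>)"] D[of "(\<xi>, snd z)"] z \<xi> by (intro K(2)) (auto simp: Q_def)
        ultimately show ?thesis using \<xi> by (simp add: g_def)
      qed
    qed fact
    then show "bounded ((\<lambda>(s, \<theta>). LINT \<xi>=u (s, \<theta>)..v (s, \<theta>)|lebesgue. (F s \<xi> ** G \<xi> \<theta>)) ` Q a b)"
      by (auto intro!: boundedI simp: case_prod_beta)
  qed fact
qed

lemma PI_parameters_composition: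
  fixes B0 N0 R0 :: "real \<Rightarrow> real^'n^'n"
    and B1 B2 N1 N2 R1 R2 :: "real \<Rightarrow> real \<Rightarrow> real^'n^'n"
  assumes B: "PI_parameters a b B0 B1 B2"
    and N: "PI_parameters a b N0 N1 N2"
    and R0: "\<And>s. s \<in> {a..b} \<Longrightarrow> R0 s = B0 s ** N0 s"
    and R1: "\<And>s \<theta>. s \<in> {a..b} \<Longrightarrow> \<theta> \<in> {a..b} \<Longrightarrow> R1 s \<theta> =
      B0 s ** N1 s \<theta> + B1 s \<theta> ** N0 \<theta>
      + (LINT \<xi>=a..\<theta>|lebesgue. (B1 s \<xi> ** N2 \<xi> \<theta>))
      + (LINT \<xi>=\<theta>..s|lebesgue. (B1 s \<xi> ** N1 \<xi> \<theta>))
      + (LINT \<xi>=s..b|lebesgue. (B2 s \<xi> ** N1 \<xi> \<theta>))"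
    and R2: "\<And>s \<theta>. s \<in> {a..b} \<Longrightarrow> \<theta> \<in> {a..b} \<Longrightarrow> R2 s \<theta> =
      B0 s ** N2 s \<theta> + B2 s \<theta> ** N0 \<theta>
      + (LINT \<xi>=a..s|lebesgue. (B1 s \<xi> ** N2 \<xi> \<theta>))
      + (LINT \<xi>=s..\<theta>|lebesgue. (B2 s \<xi> ** N2 \<xi> \<theta>))
      + (LINT \<xi>=\<theta>..b|lebesgue. (B2 s \<xi> ** N1 \<xi> \<theta>))"
  shows "PI_parameters a b R0 R1 R2"
proof -
  let ?Q = "{a..b} \<times> {a..b}"
  note B' = B[unfolded PI_parameters_def] and N' = N[unfolded PI_parameters_def]
  have [simp]: "(\<lambda>z :: real \<times> real. fst z) \<in> borel_measurable borel"
    "(\<lambda>z :: real \<times> real. snd z) \<in> borel_measurable borel"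
    by (simp_all add: borel_prod[symmetric])
  have "bounded_measurable_on {a..b} (\<lambda>s. B0 s ** N0 s)"
    using B' N' by (intro bounded_measurable_on_matrix_mult) auto
  then have "bounded_measurable_on {a..b} R0"
    by (rule bounded_measurable_on_cong[THEN iffD1, rotated]) (simp add: R0)
  moreover have "bounded_measurable_on ?Q (\<lambda>(s, \<theta>). R1 s \<theta>)"
  proof -
    \<comment> \<open>Each factor is a separate function of the point \<open>z\<close>, so the
      closure rules for sums and products apply; \<open>fst (s, \<theta>)\<close> and
      \<open>snd (s, \<theta>)\<close> exhibit the limits as functions of that point.\<close>
    have "bounded_measurable_on ?Q (\<lambda>z.
        (case z of (s, \<theta>) \<Rightarrow> B0 s) ** (case z of (s, \<theta>) \<Rightarrow> N1 s \<theta>)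
        + (case z of (s, \<theta>) \<Rightarrow> B1 s \<theta>) ** (case z of (s, \<theta>) \<Rightarrow> N0 \<theta>)
        + (case z of (s, \<theta>) \<Rightarrow> LINT \<xi>=a..snd (s, \<theta>)|lebesgue. (B1 s \<xi> ** N2 \<xi> \<theta>))
        + (case z of (s, \<theta>) \<Rightarrow> LINT \<xi>=snd (s, \<theta>)..fst (s, \<theta>)|lebesgue. (B1 s \<xi> ** N1 \<xi> \<theta>))
        + (case z of (s, \<theta>) \<Rightarrow> LINT \<xi>=fst (s, \<theta>)..b|lebesgue. (B2 s \<xi> ** N1 \<xi> \<theta>)))"
      using B' N'
      by (intro bounded_measurable_on_add bounded_measurable_on_matrix_mult
          bounded_measurable_on_fst bounded_measurable_on_snd
          bounded_measurable_on_interval_integral) auto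
    then show ?thesis
      by (rule bounded_measurable_on_cong[THEN iffD1, rotated]) (auto simp: R1)
  qed
  moreover have "bounded_measurable_on ?Q (\<lambda>(s, \<theta>). R2 s \<theta>)"
  proof -
    have "bounded_measurable_on ?Q (\<lambda>z.
        (case z of (s, \<theta>) \<Rightarrow> B0 s) ** (case z of (s, \<theta>) \<Rightarrow> N2 s \<theta>)
        + (case z of (s, \<theta>) \<Rightarrow> B2 s \<theta>) ** (case z of (s, \<theta>) \<Rightarrow> N0 \<theta>)
        + (case z of (s, \<theta>) \<Rightarrow> LINT \<xi>=a..fst (s, \<theta>)|lebesgue. (B1 s \<xi> ** N2 \<xi> \<theta>))
        + (case z of (s, \<theta>) \<Rightarrow> LINT \<xi>=fst (s, \<theta>)..snd (s, \<theta>)|lebesgue. (B2 s \<xi> ** N2 \<xi> \<theta>))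
        + (case z of (s, \<theta>) \<Rightarrow> LINT \<xi>=snd (s, \<theta>)..b|lebesgue. (B2 s \<xi> ** N1 \<xi> \<theta>)))"
      using B' N'
      by (intro bounded_measurable_on_add bounded_measurable_on_matrix_mult
          bounded_measurable_on_fst bounded_measurable_on_snd
          bounded_measurable_on_interval_integral) auto
    then show ?thesis
      by (rule bounded_measurable_on_cong[THEN iffD1, rotated]) (auto simp: R2)
  qed
  ultimately show ?thesis by (simp add: PI_parameters_def)
qed

text \<open>
  The zero value on the diagonal and outside the open square lets one product of joint kernels
  encode all the cases in the formulas for \<open>R1\<close> and \<open>R2\<close>.
\<close>

definition joint_kernel ::
  "real \<Rightarrow> real \<Rightarrow> (real \<Rightarrow> real \<Rightarrow> 'b::zero) \<Rightarrow> (real \<Rightarrow> real \<Rightarrow> 'b) \<Rightarrow> real \<Rightarrow> real \<Rightarrow> 'b"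
  where "joint_kernel a b K1 K2 s \<theta> =
    (if a < \<theta> \<and> \<theta> < s \<and> s < b then K1 s \<theta> else if a < s \<and> s < \<theta> \<and> \<theta> < b then K2 s \<theta> else 0)"

text \<open>The kernel equation needs no restriction to the square, since
  \<open>joint_kernel\<close> and \<open>k\<close> both vanish outside it. \<open>N0\<close> is not
  extended by zero, so its equation is restricted to the interval.\<close>

definition PI_representative ::
  "real \<Rightarrow> real \<Rightarrow> (real \<Rightarrow> real^'n^'n) \<Rightarrow> (real \<Rightarrow> real \<Rightarrow> real^'n^'n) \<Rightarrow> (real \<Rightarrow> real \<Rightarrow> real^'n^'n) \<Rightarrow>
    (real \<Rightarrow> real^'n^'n) \<Rightarrow> (real \<times> real \<Rightarrow> real^'n^'n) \<Rightarrow> bool"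
  where "PI_representative a b N0 N1 N2 M k \<longleftrightarrow>
    bounded_borel_on {a..b} M \<and> bounded_borel_on ({a..b} \<times> {a..b}) k \<and>
    (AE s in lborel. s \<in> {a..b} \<longrightarrow> N0 s = M s) \<and>
    (AE z in lborel. joint_kernel a b N1 N2 (fst z) (snd z) = k z)"

lemma PI_representative_exists:
  fixes N0 :: "real \<Rightarrow> real^'n^'n" and N1 N2 :: "real \<Rightarrow> real \<Rightarrow> real^'n^'n"
  assumes "PI_parameters a b N0 N1 N2"
  obtains M k where "PI_representative a b N0 N1 N2 M k"
proof -
  let ?Q = "{a..b} \<times> {a..b}"
  have Q: "?Q \<in> sets borel" by (simp add: borel_prod[symmetric])
  obtain M where M: "bounded_borel_on {a..b} M" "AE s in lborel. s \<in> {a..b} \<longrightarrow> N0 s = M s"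
    using bounded_borel_representative[of "{a..b}" N0] assms by (auto simp: PI_parameters_def)
  obtain k1 where k1: "bounded_borel_on ?Q k1"
    and k1_ae: "AE z in lborel. z \<in> ?Q \<longrightarrow> (case z of (s, \<theta>) \<Rightarrow> N1 s \<theta>) = k1 z"
    using bounded_borel_representative[of ?Q "\<lambda>(s, \<theta>). N1 s \<theta>"] assms Q
    unfolding PI_parameters_def by blast
  obtain k2 where k2: "bounded_borel_on ?Q k2"
    and k2_ae: "AE z in lborel. z \<in> ?Q \<longrightarrow> (case z of (s, \<theta>) \<Rightarrow> N2 s \<theta>) = k2 z"
    using bounded_borel_representative[of ?Q "\<lambda>(s, \<theta>). N2 s \<theta>"] assms Q
    unfolding PI_parameters_def by blast
  \<comment> \<open>Gluing the Borel versions in the same way keeps \<open>k\<close> Borel and makes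
    it vanish outside the square.\<close>
  define k where "k z = joint_kernel a b (curry k1) (curry k2) (fst z) (snd z)" for z
  have [measurable]: "k1 \<in> borel_measurable (borel \<Otimes>\<^sub>M borel)" "k2 \<in> borel_measurable (borel \<Otimes>\<^sub>M borel)"
    using k1 k2 by (simp_all add: bounded_borel_on_def borel_prod)
  have "k \<in> borel_measurable (borel \<Otimes>\<^sub>M borel)"
    unfolding k_def[abs_def] joint_kernel_def curry_def by measurable
  moreover have "bounded (range k)"
  proof -
    obtain C1 C2 where "0 \<le> C1" "\<And>z. norm (k1 z) \<le> C1" "\<And>z. norm (k2 z) \<le> C2"
      using bounded_borel_on_bound[OF k1] bounded_borel_on_bound[OF k2] by metis
    then have "norm (k z) \<le> max C1 C2" for z
      by (auto simp: k_def joint_kernel_def curry_def le_max_iff_disj)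
    then show ?thesis unfolding bounded_iff by blast
  qed
  moreover have "k z = 0" if "z \<notin> ?Q" for z
    using that by (cases z) (auto simp: k_def joint_kernel_def)
  ultimately have k: "bounded_borel_on ?Q k" by (simp add: bounded_borel_on_def borel_prod)
  have "AE z in lborel. joint_kernel a b N1 N2 (fst z) (snd z) = k z"
    using k1_ae k2_ae
    by eventually_elim (auto simp: k_def joint_kernel_def curry_def)
  with M k show ?thesis by (intro that) (simp add: PI_representative_def)
qed

section \<open>Splitting an integral at two points\<close>

lemma interval_integral_eq_indicator:
  fixes f P :: "real \<Rightarrow> 'b::{banach, second_countable_topology}" and u v :: real
  assumes "u \<le> v" "\<And>\<xi>. u < \<xi> \<Longrightarrow> \<xi> < v \<Longrightarrow> f \<xi> = P \<xi>"
  shows "(LINT \<xi>=u..v|lebesgue. f \<xi>) = (LINT \<xi>|lebesgue. indicator {u<..<v} \<xi> *\<^sub>R P \<xi>)"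
proof -
  have "(LINT \<xi>=u..v|lebesgue. f \<xi>) = (LINT \<xi>|lebesgue. indicator {u<..<v} \<xi> *\<^sub>R f \<xi>)"
    using assms(1) by (simp add: interval_lebesgue_integral_def set_lebesgue_integral_def)
  also have "\<dots> = (LINT \<xi>|lebesgue. indicator {u<..<v} \<xi> *\<^sub>R P \<xi>)"
    using assms(2) by (intro Bochner_Integration.integral_cong) (auto simp: indicator_def)
  finally show ?thesis .
qed

text \<open>Interval integrals see only open intervals, and \<open>P\<close> vanishes at the
  division points and outside, so the three restrictions of \<open>P\<close> add up to
  \<open>P\<close> at every point. The case \<open>u = v\<close> is allowed and leaves two
  pieces.\<close>

lemma integral_eq_sum_interval_integrals:
  fixes f g h P :: "real \<Rightarrow> 'b::{banach, second_countable_topology}" and a b u v :: real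
  assumes P: "integrable lebesgue P" and ord: "a \<le> u" "u \<le> v" "v \<le> b"
    and f: "\<And>\<xi>. a < \<xi> \<Longrightarrow> \<xi> < u \<Longrightarrow> f \<xi> = P \<xi>"
    and g: "\<And>\<xi>. u < \<xi> \<Longrightarrow> \<xi> < v \<Longrightarrow> g \<xi> = P \<xi>"
    and h: "\<And>\<xi>. v < \<xi> \<Longrightarrow> \<xi> < b \<Longrightarrow> h \<xi> = P \<xi>"
    and zero: "\<And>\<xi>. \<xi> \<le> a \<or> \<xi> = u \<or> \<xi> = v \<or> b \<le> \<xi> \<Longrightarrow> P \<xi> = 0"
  shows "(LINT \<xi>=a..u|lebesgue. f \<xi>) + (LINT \<xi>=u..v|lebesgue. g \<xi>) + (LINT \<xi>=v..b|lebesgue. h \<xi>) =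
    integral\<^sup>L lebesgue P"
proof -
  have int: "integrable lebesgue (\<lambda>\<xi>. indicator {c<..<d} \<xi> *\<^sub>R P \<xi>)" for c d
    by (rule integrable_mult_indicator[OF _ P]) auto
  have "(LINT \<xi>=a..u|lebesgue. f \<xi>) + (LINT \<xi>=u..v|lebesgue. g \<xi>) + (LINT \<xi>=v..b|lebesgue. h \<xi>) =
    (LINT \<xi>|lebesgue. indicator {a<..<u} \<xi> *\<^sub>R P \<xi>) + (LINT \<xi>|lebesgue. indicator {u<..<v} \<xi> *\<^sub>R P \<xi>) +
    (LINT \<xi>|lebesgue. indicator {v<..<b} \<xi> *\<^sub>R P \<xi>)"
    using interval_integral_eq_indicator[OF ord(1) f] interval_integral_eq_indicator[OF ord(2) g]
      interval_integral_eq_indicator[OF ord(3) h] by simp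
  also have "\<dots> = (LINT \<xi>|lebesgue. indicator {a<..<u} \<xi> *\<^sub>R P \<xi> + indicator {u<..<v} \<xi> *\<^sub>R P \<xi> +
    indicator {v<..<b} \<xi> *\<^sub>R P \<xi>)"
    by (subst Bochner_Integration.integral_add
        | intro Bochner_Integration.integrable_add int refl)+
  also have "\<dots> = integral\<^sup>L lebesgue P"
    by (intro Bochner_Integration.integral_cong)
      (use ord zero in \<open>auto simp: indicator_def\<close>)
  finally show ?thesis .
qed

subsection \<open>Integral operators on square-integrable functions\<close>

definition borel_L2 :: "real \<Rightarrow> real \<Rightarrow> (real \<Rightarrow> real^'n) \<Rightarrow> bool"
  where "borel_L2 a b x \<longleftrightarrow> x \<in> borel_measurable borel \<and> (\<forall>s. s \<notin> {a..b} \<longrightarrow> x s = 0) \<and>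
    integrable lborel (\<lambda>s. (norm (x s))\<^sup>2)"

text \<open>Domination by t \<le> 1 + t^2, where the 1 counts only on the interval and so has finite
  integral.\<close>

lemma borel_L2_integrable:
  fixes x :: "real \<Rightarrow> real^'n"
  assumes "borel_L2 a b x"
  shows "integrable lborel (\<lambda>s. norm (x s))"
proof -
  have [measurable]: "x \<in> borel_measurable borel" and zero: "\<And>s. s \<notin> {a..b} \<Longrightarrow> x s = 0"
    and sq: "integrable lborel (\<lambda>s. (norm (x s))\<^sup>2)"
    using assms by (auto simp: borel_L2_def)
  have "integrable lborel (indicator {a..b} :: real \<Rightarrow> real)"
    by (rule integrable_indicator_Icc)
  then have "integrable lborel (\<lambda>s. indicator {a..b} s + (norm (x s))\<^sup>2)"
    using sq by (rule Bochner_Integration.integrable_add)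
  then show ?thesis
  proof (rule Bochner_Integration.integrable_bound)
    have "norm (x s) \<le> indicator {a..b} s + (norm (x s))\<^sup>2" for s
    proof (cases "s \<in> {a..b}")
      case True
      have "0 \<le> (norm (x s) - 1)\<^sup>2" by simp
      then have "2 * norm (x s) \<le> 1 + (norm (x s))\<^sup>2"
        by (simp add: power2_eq_square algebra_simps)
      then have "norm (x s) \<le> 1 + (norm (x s))\<^sup>2"
        using norm_ge_zero[of "x s"] by linarith
      with True show ?thesis by simp
    qed (simp add: zero)
    then show "AE s in lborel. norm (norm (x s)) \<le> norm (indicator {a..b} s + (norm (x s))\<^sup>2)"
      by (intro always_eventually) auto
  qed measurable
qed

section \<open>Equality in L2 and Borel representatives\<close>

lemma AE_lebesgue_on_iff:
  "(AE s in lebesgue_on {a..b}. P s) \<longleftrightarrow> (AE s in lborel. s \<in> {a..b} \<longrightarrow> P s)" for a b :: real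
proof -
  have "(AE s in lebesgue_on {a..b}. P s) \<longleftrightarrow> (AE s in lebesgue. s \<in> {a..b} \<longrightarrow> P s)"
    by (rule AE_restrict_space_iff) auto
  then show ?thesis by (simp only: AE_completion_iff)
qed

lemma borel_L2_imp_L2_fun:
  assumes "borel_L2 a b x"
  shows "x \<in> L2_fun a b"
proof -
  have xm: "x \<in> borel_measurable lborel" and zero: "\<And>s. s \<notin> {a..b} \<Longrightarrow> x s = 0"
    and sq: "integrable lborel (\<lambda>s. (norm (x s))\<^sup>2)"
    using assms by (auto simp: borel_L2_def)
  have "integrable lebesgue (\<lambda>s. (norm (x s))\<^sup>2)"
    using sq xm by (simp add: integrable_completion)
  moreover have "(\<lambda>s. (norm (x s))\<^sup>2) = (\<lambda>s. indicator {a..b} s *\<^sub>R (norm (x s))\<^sup>2)"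
    using zero by (auto simp: indicator_def fun_eq_iff)
  ultimately have "integrable (lebesgue_on {a..b}) (\<lambda>s. (norm (x s))\<^sup>2)"
    by (subst integrable_restrict_space) simp_all
  moreover have "x \<in> borel_measurable (lebesgue_on {a..b})"
    by (rule measurable_restrict_space1[OF measurable_completion[OF xm]])
  ultimately show ?thesis by (simp add: L2_fun_def)
qed

text \<open>Square integrability of \<open>x\<close> is a conclusion: measurability and the norm
  integral both pass from \<open>y\<close> to \<open>x\<close>. This is how \<open>PI_fun\<close> of
  an element is later seen to lie in \<open>L2_fun\<close>.\<close>

lemma L2_eqI:
  fixes x y :: "real \<Rightarrow> real^'n"
  assumes y: "y \<in> L2_fun a b" and ae: "AE s in lborel. s \<in> {a..b} \<longrightarrow> x s = y s"
  shows "(x, y) \<in> L2_eq a b"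
proof -
  have ym: "y \<in> borel_measurable (lebesgue_on {a..b})"
    and sq: "integrable (lebesgue_on {a..b}) (\<lambda>s. (norm (y s))\<^sup>2)"
    using y by (auto simp: L2_fun_def)
  have ae': "AE s in lebesgue_on {a..b}. x s = y s"
    using ae by (simp only: AE_lebesgue_on_iff)
  have "(\<lambda>s. if s \<in> {a..b} then y s else 0) \<in> borel_measurable lebesgue"
    using ym by (rule borel_measurable_if_I) auto
  then have "(\<lambda>s. if s \<in> {a..b} then x s else 0) \<in> borel_measurable lebesgue"
    by (rule borel_measurable_AE) (use AE_completion[OF ae] in \<open>auto elim: eventually_mono\<close>)
  then have xm: "x \<in> borel_measurable (lebesgue_on {a..b})" by (rule borel_measurable_if_D)
  have "integrable (lebesgue_on {a..b}) (\<lambda>s. (norm (x s))\<^sup>2) \<longleftrightarrow>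
    integrable (lebesgue_on {a..b}) (\<lambda>s. (norm (y s))\<^sup>2)"
    by (rule integrable_cong_AE)
      (use xm ym ae' in \<open>auto intro: borel_measurable_power borel_measurable_norm elim: eventually_mono\<close>)
  with xm sq have "x \<in> L2_fun a b" by (simp add: L2_fun_def)
  with y ae' show ?thesis by (simp add: L2_eq_def)
qed

lemma L2_eqD:
  assumes "(x, y) \<in> L2_eq a b"
  shows "x \<in> L2_fun a b" "y \<in> L2_fun a b" "AE s in lborel. s \<in> {a..b} \<longrightarrow> x s = y s"
  using assms by (simp_all add: L2_eq_def AE_lebesgue_on_iff)

lemma borel_L2_representative:
  fixes x :: "real \<Rightarrow> real^'n"
  assumes x: "x \<in> L2_fun a b"
  obtains y where "borel_L2 a b y" "(x, y) \<in> L2_eq a b"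
proof -
  have xm: "x \<in> borel_measurable (lebesgue_on {a..b})"
    and sq: "integrable (lebesgue_on {a..b}) (\<lambda>s. (norm (x s))\<^sup>2)"
    using x by (auto simp: L2_fun_def)
  obtain y where ym: "y \<in> borel_measurable borel" and zero: "\<And>s. s \<notin> {a..b} \<Longrightarrow> y s = 0"
    and ae: "AE s in lborel. s \<in> {a..b} \<longrightarrow> x s = y s"
    using borel_representative[OF xm borel_closed[OF closed_atLeastAtMost]] by blast
  have "AE s in lborel. s \<in> {a..b} \<longrightarrow> y s = x s"
    using ae by eventually_elim simp
  \<comment> \<open>First in this direction, because only \<open>x\<close> is known to be square
    integrable so far; membership of \<open>y\<close> follows and permits the other
    direction.\<close>
  then have yx: "(y, x) \<in> L2_eq a b" by (rule L2_eqI[OF x])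
  have "integrable (lebesgue_on {a..b}) (\<lambda>s. (norm (y s))\<^sup>2)"
    using L2_eqD(1)[OF yx] by (simp add: L2_fun_def)
  then have "integrable lebesgue (\<lambda>s. indicator {a..b} s *\<^sub>R (norm (y s))\<^sup>2)"
    by (subst (asm) integrable_restrict_space) simp_all
  moreover have "(\<lambda>s. indicator {a..b} s *\<^sub>R (norm (y s))\<^sup>2) = (\<lambda>s. (norm (y s))\<^sup>2)"
    using zero by (auto simp: indicator_def fun_eq_iff)
  ultimately have "integrable lborel (\<lambda>s. (norm (y s))\<^sup>2)"
    using ym by (simp add: integrable_completion)
  with ym zero have "borel_L2 a b y" by (auto simp: borel_L2_def)
  moreover have "(x, y) \<in> L2_eq a b"
    using ae by (rule L2_eqI[OF L2_eqD(1)[OF yx]])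
  ultimately show ?thesis by (rule that)
qed

section \<open>Operators with Borel kernels\<close>

definition kernel_op :: "(real \<Rightarrow> real^'n^'n) \<Rightarrow> (real \<times> real \<Rightarrow> real^'n^'n) \<Rightarrow> (real \<Rightarrow> real^'n) \<Rightarrow> real \<Rightarrow> real^'n"
  where "kernel_op M k x s = M s *v x s + (LINT \<theta>|lborel. k (s, \<theta>) *v x \<theta>)"

lemma kernel_section_measurable:
  fixes k :: "real \<times> real \<Rightarrow> 'b::topological_space"
  assumes "k \<in> borel_measurable borel"
  shows "(\<lambda>\<theta>. k (s, \<theta>)) \<in> borel_measurable borel" "(\<lambda>s. k (s, \<theta>)) \<in> borel_measurable borel"
proof -
  have [measurable]: "k \<in> borel_measurable (borel \<Otimes>\<^sub>M borel)"
    using assms by (simp add: borel_prod)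
  show "(\<lambda>\<theta>. k (s, \<theta>)) \<in> borel_measurable borel" "(\<lambda>s. k (s, \<theta>)) \<in> borel_measurable borel"
    by measurable
qed

lemma kernel_integrable:
  fixes k :: "real \<times> real \<Rightarrow> real^'n^'n"
  assumes k: "bounded_borel_on Q k" and x: "borel_L2 a b x"
  shows "integrable lborel (\<lambda>\<theta>. k (s, \<theta>) *v x \<theta>)"
proof -
  have [measurable]: "x \<in> borel_measurable borel" using x by (auto simp: borel_L2_def)
  have [measurable]: "(\<lambda>\<theta>. k (s, \<theta>)) \<in> borel_measurable borel"
    using k by (intro kernel_section_measurable) (simp add: bounded_borel_on_def)
  obtain C where C: "\<And>z. norm (k z) \<le> C" using bounded_borel_on_bound[OF k] by blast
  obtain K where "0 < K" and K: "\<And>A v c d. norm (A :: real^'n^'n) \<le> c \<Longrightarrow> norm (v :: real^'n) \<le> d \<Longrightarrow>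
      norm (A *v v) \<le> c * d * K"
    using bounded_bilinear_norm_le[OF bounded_bilinear_matrix_vector_mult] by blast
  have "integrable lborel (\<lambda>\<theta>. C * norm (x \<theta>) * K)"
    using borel_L2_integrable[OF x] by simp
  then show ?thesis
  proof (rule Bochner_Integration.integrable_bound)
    show "AE \<theta> in lborel. norm (k (s, \<theta>) *v x \<theta>) \<le> norm (C * norm (x \<theta>) * K)"
      using K[OF C order_refl] by (intro always_eventually allI) (metis abs_ge_self order_trans real_norm_def)
  qed measurable
qed

text \<open>The integral part is bounded by a constant \<open>I\<close> independent of
  \<open>s\<close>, because \<open>x\<close> is integrable and \<open>k\<close> bounded. A constant
  is square integrable only over a bounded set, which is why \<open>le2\<close> carries an
  indicator, justified by the vanishing of the result outside the interval.\<close>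

lemma kernel_op_borel_L2:
  fixes M :: "real \<Rightarrow> real^'n^'n"
  assumes M: "bounded_borel_on {a..b} M" and k: "bounded_borel_on ({a..b} \<times> {a..b}) k"
    and x: "borel_L2 a b x"
  shows "borel_L2 a b (kernel_op M k x)"
proof -
  have [measurable]: "x \<in> borel_measurable borel" and x0: "\<And>s. s \<notin> {a..b} \<Longrightarrow> x s = 0"
    and sq: "integrable lborel (\<lambda>s. (norm (x s))\<^sup>2)"
    using x by (auto simp: borel_L2_def)
  have [measurable]: "M \<in> borel_measurable borel" "k \<in> borel_measurable (borel \<Otimes>\<^sub>M borel)"
    using M k by (simp_all add: bounded_borel_on_def borel_prod)
  have zero: "kernel_op M k x s = 0" if "s \<notin> {a..b}" for s
  proof -
    have "M s = 0" "k (s, \<theta>) = 0" for \<theta>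
      using M k that by (auto simp: bounded_borel_on_def)
    then show ?thesis by (simp add: kernel_op_def)
  qed
  have [measurable]: "kernel_op M k x \<in> borel_measurable borel"
    unfolding kernel_op_def[abs_def] by measurable
  obtain C where C: "\<And>s. norm (M s) \<le> C" using bounded_borel_on_bound[OF M] by blast
  obtain D where D: "\<And>z. norm (k z) \<le> D" using bounded_borel_on_bound[OF k] by blast
  obtain K where "0 < K" and K: "\<And>A v c d. norm (A :: real^'n^'n) \<le> c \<Longrightarrow> norm (v :: real^'n) \<le> d \<Longrightarrow>
      norm (A *v v) \<le> c * d * K"
    using bounded_bilinear_norm_le[OF bounded_bilinear_matrix_vector_mult] by blast
  define I where "I = (LINT \<theta>|lborel. D * norm (x \<theta>) * K)"
  have int: "integrable lborel (\<lambda>\<theta>. D * norm (x \<theta>) * K)"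
    using borel_L2_integrable[OF x] by simp
  have le: "norm (kernel_op M k x s) \<le> C * norm (x s) * K + I" for s
  proof -
    have "norm (LINT \<theta>|lborel. k (s, \<theta>) *v x \<theta>) \<le> I"
      unfolding I_def using int K[OF D order_refl] by (rule norm_integral_le)
    with K[OF C order_refl, of s "x s"] show ?thesis
      unfolding kernel_op_def by (intro order_trans[OF norm_triangle_ineq]) simp
  qed
  have le2: "(norm (kernel_op M k x s))\<^sup>2 \<le> 2 * (C * K)\<^sup>2 * (norm (x s))\<^sup>2 + 2 * I\<^sup>2 * indicator {a..b} s" for s
  proof (cases "s \<in> {a..b}")
    case True
    have "(norm (kernel_op M k x s))\<^sup>2 \<le> (C * norm (x s) * K + I)\<^sup>2"
      using le by (intro power_mono) auto
    \<comment> \<open>(p + q)^2 \<le> 2 p^2 + 2 q^2, which is (p - q)^2 \<ge> 0 rearranged.\<close>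
    also have "\<dots> \<le> 2 * (C * norm (x s) * K)\<^sup>2 + 2 * I\<^sup>2"
      using zero_le_power2[of "C * norm (x s) * K - I"] by (simp add: power2_sum power2_diff)
    finally show ?thesis using True by (simp add: power_mult_distrib mult_ac)
  qed (simp add: zero)
  have "integrable lborel (indicator {a..b} :: real \<Rightarrow> real)"
    by (rule integrable_indicator_Icc)
  then have "integrable lborel (\<lambda>s. 2 * (C * K)\<^sup>2 * (norm (x s))\<^sup>2 + 2 * I\<^sup>2 * indicator {a..b} s)"
    using sq by (intro Bochner_Integration.integrable_add integrable_mult_right)
  then have "integrable lborel (\<lambda>s. (norm (kernel_op M k x s))\<^sup>2)"
  proof (rule Bochner_Integration.integrable_bound)
    show "AE s in lborel. norm ((norm (kernel_op M k x s))\<^sup>2) \<le>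
      norm (2 * (C * K)\<^sup>2 * (norm (x s))\<^sup>2 + 2 * I\<^sup>2 * indicator {a..b} s)"
      using le2 by (intro always_eventually allI) (simp add: order_trans[OF _ abs_ge_self])
  qed measurable
  with zero show ?thesis by (auto simp: borel_L2_def)
qed

text \<open>Allowing \<open>x\<close> and \<open>y\<close> to differ on a null set makes the lemma
  do two jobs: it passes to Borel data and, with the same \<open>y\<close> for several
  \<open>x\<close>, shows that the choice of representative does not matter.\<close>

lemma PI_fun_representative:
  fixes N0 :: "real \<Rightarrow> real^'n^'n" and N1 N2 :: "real \<Rightarrow> real \<Rightarrow> real^'n^'n"
  assumes rep: "PI_representative a b N0 N1 N2 M k"
    and xy: "(x, y) \<in> L2_eq a b" and y: "borel_L2 a b y"
  shows "(PI_fun a b N0 N1 N2 x, kernel_op M k y) \<in> L2_eq a b" "borel_L2 a b (kernel_op M k y)"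
proof -
  have M: "bounded_borel_on {a..b} M" and k: "bounded_borel_on ({a..b} \<times> {a..b}) k"
    and M_ae: "AE s in lborel. s \<in> {a..b} \<longrightarrow> N0 s = M s"
    and k_ae: "AE z in lborel. joint_kernel a b N1 N2 (fst z) (snd z) = k z"
    using rep by (auto simp: PI_representative_def)
  show L2: "borel_L2 a b (kernel_op M k y)" by (rule kernel_op_borel_L2[OF M k y])
  have [measurable]: "y \<in> borel_measurable borel" using y by (simp add: borel_L2_def)
  show "(PI_fun a b N0 N1 N2 x, kernel_op M k y) \<in> L2_eq a b"
  proof (rule L2_eqI[OF borel_L2_imp_L2_fun[OF L2]])
    show "AE s in lborel. s \<in> {a..b} \<longrightarrow> PI_fun a b N0 N1 N2 x s = kernel_op M k y s"
      \<comment> \<open>The endpoints are excluded because for \<open>s = a\<close> or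
        \<open>s = b\<close> the joint kernel is identically zero, while \<open>PI_fun\<close> still
        integrates over the whole interval.\<close>
      using M_ae L2_eqD(3)[OF xy] AE_lborel_section1[OF k_ae] AE_lborel_singleton[of a] AE_lborel_singleton[of b]
    proof eventually_elim
      case (elim s)
      show ?case
      proof
        assume s: "s \<in> {a..b}"
        define P where "P \<theta> = joint_kernel a b N1 N2 s \<theta> *v x \<theta>" for \<theta>
        have [measurable]: "(\<lambda>\<theta>. k (s, \<theta>)) \<in> borel_measurable borel"
          using k by (intro kernel_section_measurable) (simp add: bounded_borel_on_def)
        have g: "(\<lambda>\<theta>. k (s, \<theta>) *v y \<theta>) \<in> borel_measurable borel" by measurable
        have ae: "AE \<theta> in lborel. P \<theta> = k (s, \<theta>) *v y \<theta>"
          using elim(3) L2_eqD(3)[OF xy]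
        proof eventually_elim
          case (elim \<theta>)
          show ?case
          proof (cases "\<theta> \<in> {a..b}")
            case True
            with elim show ?thesis by (simp add: P_def)
          next
            case False
            with s have "joint_kernel a b N1 N2 s \<theta> = 0" by (auto simp: joint_kernel_def)
            with elim show ?thesis by (simp add: P_def)
          qed
        qed
        have P: "integrable lebesgue P"
          unfolding integrable_lebesgue_iff_lborel[OF g ae] by (rule kernel_integrable[OF k y])
        \<comment> \<open>The zero integral over a degenerate interval is a placeholder: the
          three-piece splitting is used with both division points equal to \<open>s\<close>.\<close>
        have "(LINT \<theta>=a..s|lebesgue. (N1 s \<theta> *v x \<theta>)) + (LINT \<theta>=s..s|lebesgue. 0) +
            (LINT \<theta>=s..b|lebesgue. (N2 s \<theta> *v x \<theta>)) = integral\<^sup>L lebesgue P"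
          by (rule integral_eq_sum_interval_integrals[OF P])
            (use s elim in \<open>auto simp: P_def joint_kernel_def\<close>)
        also have "\<dots> = (LINT \<theta>|lborel. k (s, \<theta>) *v y \<theta>)"
          by (rule integral_lebesgue_eq_lborel[OF g ae])
        finally show "PI_fun a b N0 N1 N2 x s = kernel_op M k y s"
          using elim s
          by (simp add: PI_fun_def kernel_op_def interval_lebesgue_integral_def set_lebesgue_integral_def)
      qed
    qed
  qed
qed

text \<open>Both images equal \<open>kernel_op M k z\<close> almost everywhere, for one Borel
  representative \<open>z\<close> of the common class.\<close>

lemma PI_fun_L2:
  fixes N0 :: "real \<Rightarrow> real^'n^'n"
  assumes N: "PI_parameters a b N0 N1 N2" and xy: "(x, y) \<in> L2_eq a b"
  shows "(PI_fun a b N0 N1 N2 x, PI_fun a b N0 N1 N2 y) \<in> L2_eq a b"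
proof -
  obtain M k where rep: "PI_representative a b N0 N1 N2 M k"
    using PI_representative_exists[OF N] .
  obtain z where z: "borel_L2 a b z" "(y, z) \<in> L2_eq a b"
    using borel_L2_representative[OF L2_eqD(2)[OF xy]] .
  have "trans (L2_eq a b :: ((real \<Rightarrow> real^'n) \<times> _) set)" "sym (L2_eq a b :: ((real \<Rightarrow> real^'n) \<times> _) set)"
    using equiv_L2_eq[of a b] by (auto simp: equiv_def)
  have "(x, z) \<in> L2_eq a b" using \<open>trans (L2_eq a b)\<close> xy z(2) by (rule transD)
  from PI_fun_representative(1)[OF rep this z(1)] PI_fun_representative(1)[OF rep z(2,1)]
  show ?thesis using \<open>trans (L2_eq a b)\<close> \<open>sym (L2_eq a b)\<close> by (meson symD transD)
qed

section \<open>The induced operators on classes\<close>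

lemma PI_op_class:
  assumes N: "PI_parameters a b N0 N1 N2" and x: "x \<in> L2_fun a b"
  shows "PI_op a b N0 N1 N2 (L2_eq a b `` {x}) = L2_eq a b `` {PI_fun a b N0 N1 N2 x}"
  unfolding PI_op_def
proof (rule UN_equiv_class[OF equiv_L2_eq _ x])
  show "(\<lambda>x. L2_eq a b `` {PI_fun a b N0 N1 N2 x}) respects L2_eq a b"
    by (intro congruentI equiv_class_eq[OF equiv_L2_eq] PI_fun_L2[OF N])
qed

lemma PI_fun_in_L2_fun:
  assumes N: "PI_parameters a b N0 N1 N2" and x: "x \<in> L2_fun a b"
  shows "PI_fun a b N0 N1 N2 x \<in> L2_fun a b"
proof -
  have "(x, x) \<in> L2_eq a b" using x by (simp add: L2_eq_def)
  then show ?thesis by (rule L2_eqD(1)[OF PI_fun_L2[OF N]])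
qed

lemma PI_op_L2_space:
  fixes N0 :: "real \<Rightarrow> real^'n^'n"
  assumes N: "PI_parameters a b N0 N1 N2"
  shows "PI_op a b N0 N1 N2 \<in> L2_space a b \<rightarrow> L2_space a b"
proof
  fix X :: "(real \<Rightarrow> real^'n) set" assume "X \<in> L2_space a b"
  then obtain x where x: "x \<in> L2_fun a b" and X: "X = L2_eq a b `` {x}"
    unfolding L2_space_def by (rule quotientE)
  show "PI_op a b N0 N1 N2 X \<in> L2_space a b"
    unfolding X PI_op_class[OF N x] L2_space_def
    by (rule quotientI[OF PI_fun_in_L2_fun[OF N x]])
qed

section \<open>Composition of operators with Borel kernels\<close>

lemma kernel_product_integrable:
  fixes k l :: "real \<times> real \<Rightarrow> real^'n^'n"
  assumes k: "bounded_borel_on ({a..b} \<times> {a..b}) k" and l: "bounded_borel_on ({a..b} \<times> {a..b}) l"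
  shows "integrable lborel (\<lambda>\<xi>. k (s, \<xi>) ** l (\<xi>, \<theta>))"
proof -
  have [measurable]: "(\<lambda>\<xi>. k (s, \<xi>)) \<in> borel_measurable borel" "(\<lambda>\<xi>. l (\<xi>, \<theta>)) \<in> borel_measurable borel"
    using k l by (auto intro!: kernel_section_measurable simp: bounded_borel_on_def)
  obtain C where C: "0 \<le> C" "\<And>z. norm (k z) \<le> C" using bounded_borel_on_bound[OF k] by blast
  obtain D where D: "0 \<le> D" "\<And>z. norm (l z) \<le> D" using bounded_borel_on_bound[OF l] by blast
  obtain K where "0 < K" and K: "\<And>A B c d. norm (A :: real^'n^'n) \<le> c \<Longrightarrow> norm (B :: real^'n^'n) \<le> d \<Longrightarrow>
      norm (A ** B) \<le> c * d * K"
    using bounded_bilinear_norm_le[OF bounded_bilinear_matrix_mult] by blast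
  have "integrable lborel (indicator {a..b} :: real \<Rightarrow> real)"
    by (rule integrable_indicator_Icc)
  then have "integrable lborel (\<lambda>\<xi>. C * D * K * indicator {a..b} \<xi>)"
    by (rule integrable_mult_right)
  then show ?thesis
  proof (rule Bochner_Integration.integrable_bound)
    have "norm (k (s, \<xi>) ** l (\<xi>, \<theta>)) \<le> C * D * K * indicator {a..b} \<xi>" for \<xi>
    proof (cases "\<xi> \<in> {a..b}")
      case True
      with K[OF C(2) D(2)] show ?thesis by simp
    next
      case False
      then have "k (s, \<xi>) = 0" using k by (auto simp: bounded_borel_on_def)
      with False show ?thesis by (simp add: bounded_bilinear.zero_left[OF bounded_bilinear_matrix_mult])
    qed
    then show "AE \<xi> in lborel. norm (k (s, \<xi>) ** l (\<xi>, \<theta>)) \<le> norm (C * D * K * indicator {a..b} \<xi>)"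
      using C(1) D(1) \<open>0 < K\<close> by (intro always_eventually) auto
  qed measurable
qed

text \<open>Of the four terms of the expanded product only the one with both kernels is a double
  integral, and exchanging its integrals produces the product kernel. The identity holds for every
  \<open>s\<close> because all bounds do.\<close>

lemma kernel_op_compose:
  fixes B N :: "real \<Rightarrow> real^'n^'n"
  assumes B: "bounded_borel_on {a..b} B" and k: "bounded_borel_on ({a..b} \<times> {a..b}) k"
    and N: "bounded_borel_on {a..b} N" and l: "bounded_borel_on ({a..b} \<times> {a..b}) l"
    and x: "borel_L2 a b x"
  shows "kernel_op B k (kernel_op N l x) s =
    kernel_op (\<lambda>s. B s ** N s)
      (\<lambda>(s, \<theta>). B s ** l (s, \<theta>) + k (s, \<theta>) ** N \<theta> + (LINT \<xi>|lborel. k (s, \<xi>) ** l (\<xi>, \<theta>))) x s"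
proof -
  interpret mv: bounded_bilinear "(*v) :: real^'n^'n \<Rightarrow> real^'n \<Rightarrow> real^'n"
    by (rule bounded_bilinear_matrix_vector_mult)
  have [measurable]: "x \<in> borel_measurable borel" "N \<in> borel_measurable borel"
    "k \<in> borel_measurable (borel \<Otimes>\<^sub>M borel)" "l \<in> borel_measurable (borel \<Otimes>\<^sub>M borel)"
    using k l x N by (simp_all add: bounded_borel_on_def borel_L2_def borel_prod)
  obtain C where C: "0 \<le> C" "\<And>z. norm (k z) \<le> C" using bounded_borel_on_bound[OF k] by blast
  obtain D where D: "0 \<le> D" "\<And>z. norm (l z) \<le> D" using bounded_borel_on_bound[OF l] by blast
  obtain E where E: "0 \<le> E" "\<And>z. norm (N z) \<le> E" using bounded_borel_on_bound[OF N] by blast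
  obtain K where "0 < K" and K: "\<And>A v c d. norm (A :: real^'n^'n) \<le> c \<Longrightarrow> norm (v :: real^'n) \<le> d \<Longrightarrow>
      norm (A *v v) \<le> c * d * K"
    using bounded_bilinear_norm_le[OF bounded_bilinear_matrix_vector_mult] by blast
  define f where "f \<xi> \<theta> = k (s, \<xi>) *v (l (\<xi>, \<theta>) *v x \<theta>)" for \<xi> \<theta>
  have nx: "integrable lborel (\<lambda>\<theta>. norm (x \<theta>))" by (rule borel_L2_integrable[OF x])
  have lx: "integrable lborel (\<lambda>\<theta>. l (\<xi>, \<theta>) *v x \<theta>)" for \<xi> by (rule kernel_integrable[OF l x])
  have ind: "integrable lborel (indicator {a..b} :: real \<Rightarrow> real)"
    by (rule integrable_indicator_Icc)
  have f: "integrable (lborel \<Otimes>\<^sub>M lborel) (case_prod f)"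
  proof (rule Bochner_Integration.integrable_bound)
    \<comment> \<open>The dominating function is a product of one-variable functions: the indicator
      controls \<xi>, since \<open>k\<close> vanishes outside the square, and the L1 function
      \<open>x\<close> controls \<theta>.\<close>
    show "integrable (lborel \<Otimes>\<^sub>M lborel) (\<lambda>(\<xi>, \<theta>). indicator {a..b} \<xi> * (C * (D * norm (x \<theta>) * K) * K))"
    proof (rule lborel_pair.Fubini_integrable)
      show "integrable lborel (\<lambda>\<xi>. LINT \<theta>|lborel. norm (case (\<xi>, \<theta>) of (\<xi>, \<theta>) \<Rightarrow>
          indicator {a..b} \<xi> * (C * (D * norm (x \<theta>) * K) * K)))"
        using ind by (simp add: abs_mult)
      show "AE \<xi> in lborel. integrable lborel (\<lambda>\<theta>. case (\<xi>, \<theta>) of (\<xi>, \<theta>) \<Rightarrow>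
          indicator {a..b} \<xi> * (C * (D * norm (x \<theta>) * K) * K))"
        using nx by simp
    qed measurable
    show "case_prod f \<in> borel_measurable (lborel \<Otimes>\<^sub>M lborel)"
      unfolding f_def[abs_def] by measurable
    have "norm (f \<xi> \<theta>) \<le> indicator {a..b} \<xi> * (C * (D * norm (x \<theta>) * K) * K)" for \<xi> \<theta>
    proof (cases "\<xi> \<in> {a..b}")
      case True
      with K[OF C(2) K[OF D(2) order_refl]] show ?thesis by (simp add: f_def)
    next
      case False
      then have "k (s, \<xi>) = 0" using k by (auto simp: bounded_borel_on_def)
      with False show ?thesis by (simp add: f_def)
    qed
    then show "AE z in lborel \<Otimes>\<^sub>M lborel. norm (case_prod f z) \<le>
        norm (case z of (\<xi>, \<theta>) \<Rightarrow> indicator {a..b} \<xi> * (C * (D * norm (x \<theta>) * K) * K))"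
      by (intro always_eventually) (auto intro: order_trans[OF _ abs_ge_self])
  qed
  have kN: "integrable lborel (\<lambda>\<xi>. k (s, \<xi>) *v (N \<xi> *v x \<xi>))"
  proof (rule Bochner_Integration.integrable_bound)
    show "integrable lborel (\<lambda>\<xi>. C * (E * norm (x \<xi>) * K) * K)" using nx by simp
    show "AE \<xi> in lborel. norm (k (s, \<xi>) *v (N \<xi> *v x \<xi>)) \<le> norm (C * (E * norm (x \<xi>) * K) * K)"
      using K[OF C(2) K[OF E(2) order_refl]]
      by (intro always_eventually) (auto intro: order_trans[OF _ abs_ge_self])
  qed measurable
  have inner: "(LINT \<theta>|lborel. f \<xi> \<theta>) = k (s, \<xi>) *v (LINT \<theta>|lborel. l (\<xi>, \<theta>) *v x \<theta>)" for \<xi>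
    unfolding f_def by (rule integral_bounded_linear[OF mv.bounded_linear_right lx])
  have inner': "(LINT \<xi>|lborel. f \<xi> \<theta>) = (LINT \<xi>|lborel. k (s, \<xi>) ** l (\<xi>, \<theta>)) *v x \<theta>" for \<theta>
    unfolding f_def matrix_vector_mul_assoc
    by (rule integral_bounded_linear[OF mv.bounded_linear_left kernel_product_integrable[OF k l]])
  have kf: "integrable lborel (\<lambda>\<xi>. LINT \<theta>|lborel. f \<xi> \<theta>)"
    and kf': "integrable lborel (\<lambda>\<theta>. LINT \<xi>|lborel. f \<xi> \<theta>)"
    using lborel_pair.integrable_fst[OF f] lborel_pair.integrable_snd[OF f] .
  have Bl: "integrable lborel (\<lambda>\<theta>. B s *v (l (s, \<theta>) *v x \<theta>))"
    by (rule integrable_bounded_linear[OF mv.bounded_linear_right lx])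
  have "kernel_op B k (kernel_op N l x) s =
    B s *v (N s *v x s) + B s *v (LINT \<theta>|lborel. l (s, \<theta>) *v x \<theta>) +
    (LINT \<xi>|lborel. k (s, \<xi>) *v (N \<xi> *v x \<xi>) + (LINT \<theta>|lborel. f \<xi> \<theta>))"
    by (simp add: kernel_op_def inner mv.add_right)
  also have "\<dots> = B s *v (N s *v x s) + (LINT \<theta>|lborel. B s *v (l (s, \<theta>) *v x \<theta>)) +
    ((LINT \<xi>|lborel. k (s, \<xi>) *v (N \<xi> *v x \<xi>)) + (LINT \<xi>|lborel. LINT \<theta>|lborel. f \<xi> \<theta>))"
    using Bochner_Integration.integral_add[OF kN kf]
      integral_bounded_linear[OF mv.bounded_linear_right lx, of "B s" s] by simp
  also have "(LINT \<xi>|lborel. LINT \<theta>|lborel. f \<xi> \<theta>) = (LINT \<theta>|lborel. LINT \<xi>|lborel. f \<xi> \<theta>)"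
    by (rule lborel_pair.Fubini_integral[OF f, symmetric])
  also have "B s *v (N s *v x s) + (LINT \<theta>|lborel. B s *v (l (s, \<theta>) *v x \<theta>)) +
    ((LINT \<xi>|lborel. k (s, \<xi>) *v (N \<xi> *v x \<xi>)) + (LINT \<theta>|lborel. LINT \<xi>|lborel. f \<xi> \<theta>)) =
    B s *v (N s *v x s) + (LINT \<theta>|lborel. B s *v (l (s, \<theta>) *v x \<theta>) +
      k (s, \<theta>) *v (N \<theta> *v x \<theta>) + (LINT \<xi>|lborel. f \<xi> \<theta>))"
    using Bochner_Integration.integral_add[OF Bochner_Integration.integrable_add[OF Bl kN] kf']
      Bochner_Integration.integral_add[OF Bl kN] by (simp add: add_ac)
  also have "\<dots> = kernel_op (\<lambda>s. B s ** N s)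
      (\<lambda>(s, \<theta>). B s ** l (s, \<theta>) + k (s, \<theta>) ** N \<theta> + (LINT \<xi>|lborel. k (s, \<xi>) ** l (\<xi>, \<theta>))) x s"
    by (simp add: kernel_op_def inner' mv.add_left matrix_vector_mul_assoc)
  finally show ?thesis .
qed

subsection \<open>Composition\<close>

text \<open>In the product \<open>P\<close>, the position of \<xi> relative to \<open>s\<close>
  selects \<open>B1\<close> or \<open>B2\<close>, and its position relative to \<theta> selects
  \<open>N1\<close> or \<open>N2\<close>; this yields exactly the three integrands of
  \<open>R1\<close> when \<theta> < s and of \<open>R2\<close> when s < \<theta>. The diagonal is
  excluded because there the joint kernels vanish while the integral of \<open>P\<close> need
  not.\<close>

lemma joint_kernel_composition:
  fixes B0 N0 :: "real \<Rightarrow> real^'n^'n" and B1 B2 N1 N2 R1 R2 :: "real \<Rightarrow> real \<Rightarrow> real^'n^'n"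
    and a b :: real
  defines "P \<equiv> \<lambda>s \<theta> \<xi>. joint_kernel a b B1 B2 s \<xi> ** joint_kernel a b N1 N2 \<xi> \<theta>"
  assumes R1: "\<And>s \<theta>. s \<in> {a..b} \<Longrightarrow> \<theta> \<in> {a..b} \<Longrightarrow> R1 s \<theta> =
      B0 s ** N1 s \<theta> + B1 s \<theta> ** N0 \<theta>
      + (LINT \<xi>=a..\<theta>|lebesgue. (B1 s \<xi> ** N2 \<xi> \<theta>))
      + (LINT \<xi>=\<theta>..s|lebesgue. (B1 s \<xi> ** N1 \<xi> \<theta>))
      + (LINT \<xi>=s..b|lebesgue. (B2 s \<xi> ** N1 \<xi> \<theta>))"
    and R2: "\<And>s \<theta>. s \<in> {a..b} \<Longrightarrow> \<theta> \<in> {a..b} \<Longrightarrow> R2 s \<theta> =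
      B0 s ** N2 s \<theta> + B2 s \<theta> ** N0 \<theta>
      + (LINT \<xi>=a..s|lebesgue. (B1 s \<xi> ** N2 \<xi> \<theta>))
      + (LINT \<xi>=s..\<theta>|lebesgue. (B2 s \<xi> ** N2 \<xi> \<theta>))
      + (LINT \<xi>=\<theta>..b|lebesgue. (B2 s \<xi> ** N1 \<xi> \<theta>))"
    and int: "integrable lebesgue (P s \<theta>)" and ne: "s \<noteq> \<theta>"
  shows "joint_kernel a b R1 R2 s \<theta> =
    B0 s ** joint_kernel a b N1 N2 s \<theta> + joint_kernel a b B1 B2 s \<theta> ** N0 \<theta> + integral\<^sup>L lebesgue (P s \<theta>)"
proof -
  interpret mm: bounded_bilinear "(**) :: real^'n^'n \<Rightarrow> real^'n^'n \<Rightarrow> real^'n^'n"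
    by (rule bounded_bilinear_matrix_mult)
  consider "a < \<theta>" "\<theta> < s" "s < b" | "a < s" "s < \<theta>" "\<theta> < b" | "s \<notin> {a<..<b} \<or> \<theta> \<notin> {a<..<b}"
    using ne by force
  then show ?thesis
  proof cases
    case 1
    have "(LINT \<xi>=a..\<theta>|lebesgue. (B1 s \<xi> ** N2 \<xi> \<theta>)) + (LINT \<xi>=\<theta>..s|lebesgue. (B1 s \<xi> ** N1 \<xi> \<theta>))
      + (LINT \<xi>=s..b|lebesgue. (B2 s \<xi> ** N1 \<xi> \<theta>)) = integral\<^sup>L lebesgue (P s \<theta>)"
      by (rule integral_eq_sum_interval_integrals[OF int])
        (use 1 in \<open>auto simp: P_def joint_kernel_def\<close>)
    with 1 R1[of s \<theta>] show ?thesis by (simp add: joint_kernel_def add.assoc)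
  next
    case 2
    have "(LINT \<xi>=a..s|lebesgue. (B1 s \<xi> ** N2 \<xi> \<theta>)) + (LINT \<xi>=s..\<theta>|lebesgue. (B2 s \<xi> ** N2 \<xi> \<theta>))
      + (LINT \<xi>=\<theta>..b|lebesgue. (B2 s \<xi> ** N1 \<xi> \<theta>)) = integral\<^sup>L lebesgue (P s \<theta>)"
      by (rule integral_eq_sum_interval_integrals[OF int])
        (use 2 in \<open>auto simp: P_def joint_kernel_def\<close>)
    with 2 R2[of s \<theta>] show ?thesis by (simp add: joint_kernel_def add.assoc)
  next
    case 3
    have z: "joint_kernel a b K1 K2 s \<theta> = 0" for K1 K2 :: "real \<Rightarrow> real \<Rightarrow> real^'n^'n"
      using 3 by (auto simp: joint_kernel_def)
    have "P s \<theta> = (\<lambda>\<xi>. 0)"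
      using 3 by (auto simp: P_def joint_kernel_def fun_eq_iff)
    then show ?thesis by (simp add: z)
  qed
qed

lemma AE_lborel_off_diagonal: "AE z in (lborel :: (real \<times> real) measure). fst z \<noteq> snd z"
proof -
  have "AE z in lborel \<Otimes>\<^sub>M lborel. fst z \<noteq> (snd z :: real)"
  proof (rule lborel_pair.AE_pair_measure)
    show "{z \<in> space (lborel \<Otimes>\<^sub>M lborel). fst z \<noteq> (snd z :: real)} \<in> sets (lborel \<Otimes>\<^sub>M lborel)"
      by measurable
    have "AE \<theta> in lborel. s \<noteq> \<theta>" for s :: real
      using AE_lborel_singleton[of s] by eventually_elim auto
    then show "AE s in lborel. AE \<theta> in lborel. fst (s, \<theta>) \<noteq> (snd (s, \<theta>) :: real)"
      by simp
  qed
  then show ?thesis by (simp only: lborel_prod)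
qed

lemma PI_fun_composition:
  fixes B0 N0 R0 :: "real \<Rightarrow> real^'n^'n" and B1 B2 N1 N2 R1 R2 :: "real \<Rightarrow> real \<Rightarrow> real^'n^'n"
  assumes B: "PI_parameters a b B0 B1 B2"
    and N: "PI_parameters a b N0 N1 N2"
    and R: "PI_parameters a b R0 R1 R2"
    and R0: "\<And>s. s \<in> {a..b} \<Longrightarrow> R0 s = B0 s ** N0 s"
    and R1: "\<And>s \<theta>. s \<in> {a..b} \<Longrightarrow> \<theta> \<in> {a..b} \<Longrightarrow> R1 s \<theta> =
      B0 s ** N1 s \<theta> + B1 s \<theta> ** N0 \<theta>
      + (LINT \<xi>=a..\<theta>|lebesgue. (B1 s \<xi> ** N2 \<xi> \<theta>))
      + (LINT \<xi>=\<theta>..s|lebesgue. (B1 s \<xi> ** N1 \<xi> \<theta>))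
      + (LINT \<xi>=s..b|lebesgue. (B2 s \<xi> ** N1 \<xi> \<theta>))"
    and R2: "\<And>s \<theta>. s \<in> {a..b} \<Longrightarrow> \<theta> \<in> {a..b} \<Longrightarrow> R2 s \<theta> =
      B0 s ** N2 s \<theta> + B2 s \<theta> ** N0 \<theta>
      + (LINT \<xi>=a..s|lebesgue. (B1 s \<xi> ** N2 \<xi> \<theta>))
      + (LINT \<xi>=s..\<theta>|lebesgue. (B2 s \<xi> ** N2 \<xi> \<theta>))
      + (LINT \<xi>=\<theta>..b|lebesgue. (B2 s \<xi> ** N1 \<xi> \<theta>))"
    and x: "x \<in> L2_fun a b"
  shows "(PI_fun a b R0 R1 R2 x, PI_fun a b B0 B1 B2 (PI_fun a b N0 N1 N2 x)) \<in> L2_eq a b"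
proof -
  obtain B' k where repB: "PI_representative a b B0 B1 B2 B' k" using PI_representative_exists[OF B] .
  obtain N' l where repN: "PI_representative a b N0 N1 N2 N' l" using PI_representative_exists[OF N] .
  obtain R' m where repR: "PI_representative a b R0 R1 R2 R' m" using PI_representative_exists[OF R] .
  obtain y where y: "borel_L2 a b y" "(x, y) \<in> L2_eq a b" using borel_L2_representative[OF x] .
  note N_y = PI_fun_representative[OF repN y(2,1)]
  \<comment> \<open>The two conclusions in \<open>N_y\<close> are precisely the premises for
    applying the second operator to the image of the first.\<close>
  note BN_y = PI_fun_representative[OF repB N_y]
  note R_y = PI_fun_representative[OF repR y(2,1)]
  have B': "bounded_borel_on {a..b} B'" and k: "bounded_borel_on ({a..b} \<times> {a..b}) k"
    and B'_ae: "AE s in lborel. s \<in> {a..b} \<longrightarrow> B0 s = B' s"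
    and k_ae: "AE z in lborel. joint_kernel a b B1 B2 (fst z) (snd z) = k z"
    using repB by (auto simp: PI_representative_def)
  have N': "bounded_borel_on {a..b} N'" and l: "bounded_borel_on ({a..b} \<times> {a..b}) l"
    and N'_ae: "AE s in lborel. s \<in> {a..b} \<longrightarrow> N0 s = N' s"
    and l_ae: "AE z in lborel. joint_kernel a b N1 N2 (fst z) (snd z) = l z"
    using repN by (auto simp: PI_representative_def)
  have m: "bounded_borel_on ({a..b} \<times> {a..b}) m"
    and R'_ae: "AE s in lborel. s \<in> {a..b} \<longrightarrow> R0 s = R' s"
    and m_ae: "AE z in lborel. joint_kernel a b R1 R2 (fst z) (snd z) = m z"
    using repR by (auto simp: PI_representative_def)
  have [measurable]: "y \<in> borel_measurable borel" "N' \<in> borel_measurable borel"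
    "k \<in> borel_measurable (borel \<Otimes>\<^sub>M borel)" "l \<in> borel_measurable (borel \<Otimes>\<^sub>M borel)"
    "m \<in> borel_measurable (borel \<Otimes>\<^sub>M borel)"
    using k l m N' y by (simp_all add: bounded_borel_on_def borel_L2_def borel_prod)
  define q where "q = (\<lambda>(s, \<theta>). B' s ** l (s, \<theta>) + k (s, \<theta>) ** N' \<theta> + (LINT \<xi>|lborel. k (s, \<xi>) ** l (\<xi>, \<theta>)))"
  have zero: "joint_kernel a b K1 K2 s \<theta> = 0" if "s \<notin> {a..b} \<or> \<theta> \<notin> {a..b}"
    for s \<theta> and K1 K2 :: "real \<Rightarrow> real \<Rightarrow> real^'n^'n"
    using that by (auto simp: joint_kernel_def)
  interpret mm: bounded_bilinear "(**) :: real^'n^'n \<Rightarrow> real^'n^'n \<Rightarrow> real^'n^'n"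
    by (rule bounded_bilinear_matrix_mult)
  \<comment> \<open>\<open>m\<close> was chosen for \<open>R1\<close> and \<open>R2\<close>
    independently of \<open>k\<close> and \<open>l\<close>; here it is identified with the kernel
    that Fubini produces.\<close>
  have mq: "AE z in lborel. m z = q z"
    using m_ae k_ae l_ae AE_lborel_off_diagonal AE_lborel_fst[OF B'_ae] AE_lborel_snd[OF N'_ae]
      AE_lborel_fst[OF AE_lborel_section1[OF k_ae]] AE_lborel_snd[OF AE_lborel_section2[OF l_ae]]
  proof eventually_elim
    case (elim z)
    obtain s \<theta> where z: "z = (s, \<theta>)" by (cases z)
    have [measurable]: "(\<lambda>\<xi>. k (s, \<xi>)) \<in> borel_measurable borel" "(\<lambda>\<xi>. l (\<xi>, \<theta>)) \<in> borel_measurable borel"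
      by measurable
    have g: "(\<lambda>\<xi>. k (s, \<xi>) ** l (\<xi>, \<theta>)) \<in> borel_measurable borel" by measurable
    have ae: "AE \<xi> in lborel. joint_kernel a b B1 B2 s \<xi> ** joint_kernel a b N1 N2 \<xi> \<theta> =
        k (s, \<xi>) ** l (\<xi>, \<theta>)"
      using elim(7,8) unfolding z by eventually_elim simp
    have int: "integrable lebesgue (\<lambda>\<xi>. joint_kernel a b B1 B2 s \<xi> ** joint_kernel a b N1 N2 \<xi> \<theta>)"
      unfolding integrable_lebesgue_iff_lborel[OF g ae] by (rule kernel_product_integrable[OF k l])
    have "s \<noteq> \<theta>" using elim(4) by (simp add: z)
    from joint_kernel_composition[OF R1 R2 int this]
    have "m z = B0 s ** joint_kernel a b N1 N2 s \<theta> + joint_kernel a b B1 B2 s \<theta> ** N0 \<theta> +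
        (LINT \<xi>|lborel. k (s, \<xi>) ** l (\<xi>, \<theta>))"
      using elim(1) by (simp add: z integral_lebesgue_eq_lborel[OF g ae])
    \<comment> \<open>\<open>B0\<close> and \<open>B'\<close> may differ when \<open>s\<close> is
      outside the interval, but then the joint kernel, and with it \<open>l (s, \<theta>)\<close>,
      is zero.\<close>
    moreover have "B0 s ** joint_kernel a b N1 N2 s \<theta> = B' s ** l (s, \<theta>)"
      using elim(3,5) zero[of s \<theta> N1 N2] by (cases "s \<in> {a..b}") (auto simp: z)
    moreover have "joint_kernel a b B1 B2 s \<theta> ** N0 \<theta> = k (s, \<theta>) ** N' \<theta>"
      using elim(2,6) zero[of s \<theta> B1 B2] by (cases "\<theta> \<in> {a..b}") (auto simp: z)
    ultimately show ?case by (simp add: q_def z)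
  qed
  have "AE s in lborel. s \<in> {a..b} \<longrightarrow> kernel_op R' m y s = kernel_op B' k (kernel_op N' l y) s"
    using B'_ae N'_ae R'_ae AE_lborel_section1[OF mq]
  proof eventually_elim
    case (elim s)
    show ?case
    proof
      assume s: "s \<in> {a..b}"
      have [measurable]: "B' \<in> borel_measurable borel" using B' by (simp add: bounded_borel_on_def)
      have [measurable]: "q \<in> borel_measurable (borel \<Otimes>\<^sub>M borel)"
        unfolding q_def by measurable
      \<comment> \<open>\<open>m\<close> and \<open>q\<close> agree almost everywhere in the plane,
        so for this \<open>s\<close> their sections differ only on a null set of \<theta>.\<close>
      have "(LINT \<theta>|lborel. m (s, \<theta>) *v y \<theta>) = (LINT \<theta>|lborel. q (s, \<theta>) *v y \<theta>)"
        by (rule integral_cong_AE) (use elim(4) in \<open>measurable, auto elim: eventually_mono\<close>)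
      with elim s R0[OF s] have "kernel_op R' m y s = kernel_op (\<lambda>s. B' s ** N' s) q y s"
        by (simp add: kernel_op_def)
      also have "\<dots> = kernel_op B' k (kernel_op N' l y) s"
        unfolding q_def by (rule kernel_op_compose[OF B' k N' l y(1), symmetric])
      finally show "kernel_op R' m y s = kernel_op B' k (kernel_op N' l y) s" .
    qed
  qed
  then have "(kernel_op R' m y, kernel_op B' k (kernel_op N' l y)) \<in> L2_eq a b"
    by (rule L2_eqI[OF L2_eqD(2)[OF BN_y(1)]])
  moreover have "trans (L2_eq a b :: ((real \<Rightarrow> real^'n) \<times> _) set)" "sym (L2_eq a b :: ((real \<Rightarrow> real^'n) \<times> _) set)"
    using equiv_L2_eq[of a b] by (auto simp: equiv_def)
  ultimately show ?thesis using R_y(1) BN_y(1) by (meson symD transD)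
qed

theorem lemma4:
  fixes a b :: real
    and B0 N0 R0 :: "real \<Rightarrow> real^'n^'n"
    and B1 B2 N1 N2 R1 R2 :: "real \<Rightarrow> real \<Rightarrow> real^'n^'n"
  assumes "a < b"
    and "PI_parameters a b B0 B1 B2"
    and "PI_parameters a b N0 N1 N2"
    and R0: "\<And>s. s \<in> {a..b} \<Longrightarrow> R0 s = B0 s ** N0 s"
    and R1: "\<And>s \<theta>. s \<in> {a..b} \<Longrightarrow> \<theta> \<in> {a..b} \<Longrightarrow> R1 s \<theta> =
      B0 s ** N1 s \<theta> + B1 s \<theta> ** N0 \<theta>
      + (LINT \<xi>=a..\<theta>|lebesgue. (B1 s \<xi> ** N2 \<xi> \<theta>))
      + (LINT \<xi>=\<theta>..s|lebesgue. (B1 s \<xi> ** N1 \<xi> \<theta>))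
      + (LINT \<xi>=s..b|lebesgue. (B2 s \<xi> ** N1 \<xi> \<theta>))"
    and R2: "\<And>s \<theta>. s \<in> {a..b} \<Longrightarrow> \<theta> \<in> {a..b} \<Longrightarrow> R2 s \<theta> =
      B0 s ** N2 s \<theta> + B2 s \<theta> ** N0 \<theta>
      + (LINT \<xi>=a..s|lebesgue. (B1 s \<xi> ** N2 \<xi> \<theta>))
      + (LINT \<xi>=s..\<theta>|lebesgue. (B2 s \<xi> ** N2 \<xi> \<theta>))
      + (LINT \<xi>=\<theta>..b|lebesgue. (B2 s \<xi> ** N1 \<xi> \<theta>))"
  shows "PI_parameters a b R0 R1 R2 \<and>
    PI_op a b B0 B1 B2 \<in> L2_space a b \<rightarrow> L2_space a b \<and>
    PI_op a b N0 N1 N2 \<in> L2_space a b \<rightarrow> L2_space a b \<and>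
    PI_op a b R0 R1 R2 \<in> L2_space a b \<rightarrow> L2_space a b \<and>
    (\<forall>X \<in> L2_space a b. PI_op a b R0 R1 R2 X = PI_op a b B0 B1 B2 (PI_op a b N0 N1 N2 X))"
proof (intro conjI ballI)
  note B = assms(2) and N = assms(3)
  show R: "PI_parameters a b R0 R1 R2"
    by (rule PI_parameters_composition[OF B N R0 R1 R2])
  show "PI_op a b B0 B1 B2 \<in> L2_space a b \<rightarrow> L2_space a b" by (rule PI_op_L2_space[OF B])
  show "PI_op a b N0 N1 N2 \<in> L2_space a b \<rightarrow> L2_space a b" by (rule PI_op_L2_space[OF N])
  show "PI_op a b R0 R1 R2 \<in> L2_space a b \<rightarrow> L2_space a b" by (rule PI_op_L2_space[OF R])
  fix X :: "(real \<Rightarrow> real^'n) set"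
  assume "X \<in> L2_space a b"
  then obtain x where x: "x \<in> L2_fun a b" and X: "X = L2_eq a b `` {x}"
    unfolding L2_space_def by (rule quotientE)
  have "PI_op a b B0 B1 B2 (PI_op a b N0 N1 N2 X) =
    L2_eq a b `` {PI_fun a b B0 B1 B2 (PI_fun a b N0 N1 N2 x)}"
    by (simp add: X PI_op_class[OF N x] PI_op_class[OF B PI_fun_in_L2_fun[OF N x]])
  also have "\<dots> = L2_eq a b `` {PI_fun a b R0 R1 R2 x}"
    by (rule equiv_class_eq[OF equiv_L2_eq PI_fun_composition[OF B N R R0 R1 R2 x], symmetric])
  also have "\<dots> = PI_op a b R0 R1 R2 X"
    by (simp add: X PI_op_class[OF R x])
  finally show "PI_op a b R0 R1 R2 X = PI_op a b B0 B1 B2 (PI_op a b N0 N1 N2 X)" ..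
qed

end
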